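(* Let $A$ be an operator algebra (not necessarily approximately unital), let $p$ be an open projection in $A^{**}$, and let $b \in A$ with $bp = pb$. Then $b$ achieves its distance to the left ideal $J = \{ a \in A : ap = a \}$; that is, there exists $x \in J$ with $\Vert b - x \Vert = d(b,J) = \inf\{\Vert b - y\Vert : y \in J\}$.
   Context: An operator algebra is a norm closed algebra $A$ of operators on a Hilbert space, not assumed to have an identity. It is approximately unital if it has a (two-sided) contractive approximate identity. The bidual $A^{**}$ is an operator algebra with its (unique) Arens product; if $A$ is a closed subalgebra of a $C^*$-algebra $B$ then $A^{**}$ is identified with the weak* closed subalgebra $A^{\perp\perp}$ of the von Neumann algebra $B^{**}$, and $A \subset A^{**}$ canonically. A projection always means an orthogonal (self-adjoint) projection. A projection $p \in A^{**}$ is open if there is a net $(x_t)$ in $A$ with $x_t = p x_t \to p$ weak* (equivalently, a net in $A$ with $x_t = p x_t p \to p$ weak* ). The set $J$ is the so-called $\ell$-ideal (left ideal with a right contractive approximate identity) associated with $p$. *)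

theory Defs
  imports "HOL-Analysis.Analysis"
begin

section \<open>Complex normed spaces and complex Hilbert spaces\<close>

class complex_normed_vector = real_normed_vector +
  fixes scaleC :: "complex \<Rightarrow> 'a \<Rightarrow> 'a"  (infixr \<open>*\<^sub>C\<close> 75)
  assumes scaleC_add_right: "c *\<^sub>C (x + y) = c *\<^sub>C x + c *\<^sub>C y"
    and scaleC_add_left: "(c + d) *\<^sub>C x = c *\<^sub>C x + d *\<^sub>C x"
    and scaleC_scaleC: "c *\<^sub>C d *\<^sub>C x = (c * d) *\<^sub>C x"
    and scaleC_of_real: "complex_of_real r *\<^sub>C x = r *\<^sub>R x"
    and norm_scaleC: "norm (c *\<^sub>C x) = cmod c * norm x"

instantiation complex :: complex_normed_vector
begin

definition scaleC_complex :: "complex \<Rightarrow> complex \<Rightarrow> complex"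
  where "scaleC_complex c z = c * z"

instance
  by standard (simp_all add: scaleC_complex_def algebra_simps norm_mult scaleR_conv_of_real)

end

text \<open>The inner product is linear in its second variable. Positive definiteness, and the
  fact that the norm is the one given by the inner product, are inherited from the real inner
  product, which is the real part of the complex one.\<close>

class complex_hilbert_space = complex_normed_vector + real_inner + complete_space +
  fixes cinner :: "'a \<Rightarrow> 'a \<Rightarrow> complex"
  assumes cinner_commute: "cinner x y = cnj (cinner y x)"
    and cinner_add_right: "cinner x (y + z) = cinner x y + cinner x z"
    and cinner_scaleC_right: "cinner x (c *\<^sub>C y) = c * cinner x y"
    and inner_eq_Re_cinner: "inner x y = Re (cinner x y)"


section \<open>Bounded complex-linear maps\<close>

definition bounded_clinear :: "('a::complex_normed_vector \<Rightarrow> 'b::complex_normed_vector) \<Rightarrow> bool"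
  where "bounded_clinear f \<longleftrightarrow> bounded_linear f \<and> (\<forall>c x. f (c *\<^sub>C x) = c *\<^sub>C f x)"

lemma bounded_clinearI:
  assumes "\<And>x y. f (x + y) = f x + f y" "\<And>c x. f (c *\<^sub>C x) = c *\<^sub>C f x"
    "\<And>x. norm (f x) \<le> norm x * K"
  shows "bounded_clinear f"
  unfolding bounded_clinear_def
proof
  show "bounded_linear f"
    by (rule bounded_linear_intro[where K = K])
      (simp_all add: assms(1,3) assms(2)[where c = "complex_of_real r" for r, unfolded scaleC_of_real])
qed (simp add: assms(2))

lemma scaleC_zero_right [simp]: "c *\<^sub>C (0::'a::complex_normed_vector) = 0"
  using scaleC_add_right[of c 0 "0::'a"] by simp

lemma scaleC_zero_left [simp]: "0 *\<^sub>C (x::'a::complex_normed_vector) = 0"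
  using scaleC_of_real[of 0 x] by simp

lemma scaleC_one [simp]: "1 *\<^sub>C (x::'a::complex_normed_vector) = x"
  using scaleC_of_real[of 1 x] by simp

lemma scaleC_minus_right: "c *\<^sub>C (- x) = - (c *\<^sub>C (x::'a::complex_normed_vector))"
  using scaleC_add_right[of c x "- x"] by (simp add: eq_neg_iff_add_eq_0 add.commute)

lemma scaleC_diff_right: "c *\<^sub>C (x - y) = c *\<^sub>C x - c *\<^sub>C (y::'a::complex_normed_vector)"
  using scaleC_add_right[of c x "- y"] by (simp add: scaleC_minus_right)

lemma scaleC_scaleR: "c *\<^sub>C r *\<^sub>R x = r *\<^sub>R c *\<^sub>C (x::'a::complex_normed_vector)"
  by (simp add: scaleC_of_real[symmetric] scaleC_scaleC mult.commute)

lemma bounded_linear_scaleC: "bounded_linear (\<lambda>x::'a::complex_normed_vector. c *\<^sub>C x)"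
  by (rule bounded_linear_intro[where K = "cmod c"])
    (simp_all add: scaleC_add_right scaleC_scaleR norm_scaleC)

lemma onorm_scaleC:
  fixes f :: "'a::complex_normed_vector \<Rightarrow> 'b::complex_normed_vector"
  assumes f: "bounded_linear f"
  shows "onorm (\<lambda>x. c *\<^sub>C f x) = cmod c * onorm f"
proof -
  have le: "onorm (\<lambda>x. d *\<^sub>C g x) \<le> cmod d * onorm g"
    if "bounded_linear g" for d and g :: "'a \<Rightarrow> 'b"
    using onorm[OF that] onorm_pos_le[OF that]
    by (intro onorm_bound) (simp_all add: norm_scaleC mult.assoc mult_left_mono)
  show ?thesis
  proof (cases "c = 0")
    case True
    then show ?thesis
      by (simp add: onorm_zero)
  next
    case False
    have g: "bounded_linear (\<lambda>x. c *\<^sub>C f x)"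
      by (rule bounded_linear_compose[OF bounded_linear_scaleC f])
    have "(\<lambda>x. inverse c *\<^sub>C c *\<^sub>C f x) = f"
      using False by (simp add: scaleC_scaleC)
    then have "onorm f \<le> cmod (inverse c) * onorm (\<lambda>x. c *\<^sub>C f x)"
      using le[OF g, of "inverse c"] by simp
    then have "cmod c * onorm f \<le> onorm (\<lambda>x. c *\<^sub>C f x)"
      using False by (simp add: norm_inverse norm_divide field_simps)
    then show ?thesis
      using le[OF f, of c] by simp
  qed
qed

typedef (overloaded) ('a, 'b) cblinfun =
  "{f :: 'a::complex_normed_vector \<Rightarrow> 'b::complex_normed_vector. bounded_clinear f}"
  morphisms cblinfun_apply CBlinfun
  by (rule exI[of _ "\<lambda>_. 0"]) (simp add: bounded_clinear_def)

type_notation cblinfun  (\<open>(_ \<Rightarrow>\<^sub>C\<^sub>L /_)\<close> [22, 21] 21)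

declare [[coercion
    "cblinfun_apply :: ('a::complex_normed_vector \<Rightarrow>\<^sub>C\<^sub>L 'b::complex_normed_vector) \<Rightarrow> 'a \<Rightarrow> 'b"]]

setup_lifting type_definition_cblinfun

lemma cblinfun_eqI: "(\<And>x. cblinfun_apply f x = cblinfun_apply g x) \<Longrightarrow> f = g"
  by transfer auto

instantiation cblinfun :: (complex_normed_vector, complex_normed_vector) complex_normed_vector
begin

lift_definition norm_cblinfun :: "'a \<Rightarrow>\<^sub>C\<^sub>L 'b \<Rightarrow> real" is onorm .

lift_definition zero_cblinfun :: "'a \<Rightarrow>\<^sub>C\<^sub>L 'b" is "\<lambda>_. 0"
  by (simp add: bounded_clinear_def)

lift_definition plus_cblinfun :: "'a \<Rightarrow>\<^sub>C\<^sub>L 'b \<Rightarrow> 'a \<Rightarrow>\<^sub>C\<^sub>L 'b \<Rightarrow> 'a \<Rightarrow>\<^sub>C\<^sub>L 'b" is "\<lambda>f g x. f x + g x"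
  by (simp add: bounded_clinear_def bounded_linear_add scaleC_add_right)

lift_definition minus_cblinfun :: "'a \<Rightarrow>\<^sub>C\<^sub>L 'b \<Rightarrow> 'a \<Rightarrow>\<^sub>C\<^sub>L 'b \<Rightarrow> 'a \<Rightarrow>\<^sub>C\<^sub>L 'b" is "\<lambda>f g x. f x - g x"
  by (simp add: bounded_clinear_def bounded_linear_sub scaleC_diff_right)

lift_definition uminus_cblinfun :: "'a \<Rightarrow>\<^sub>C\<^sub>L 'b \<Rightarrow> 'a \<Rightarrow>\<^sub>C\<^sub>L 'b" is "\<lambda>f x. - f x"
  by (simp add: bounded_clinear_def bounded_linear_minus scaleC_minus_right)

lift_definition scaleR_cblinfun :: "real \<Rightarrow> 'a \<Rightarrow>\<^sub>C\<^sub>L 'b \<Rightarrow> 'a \<Rightarrow>\<^sub>C\<^sub>L 'b" is "\<lambda>r f x. r *\<^sub>R f x"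
  by (simp add: bounded_clinear_def bounded_linear_const_scaleR scaleC_scaleR)

lift_definition scaleC_cblinfun :: "complex \<Rightarrow> 'a \<Rightarrow>\<^sub>C\<^sub>L 'b \<Rightarrow> 'a \<Rightarrow>\<^sub>C\<^sub>L 'b" is "\<lambda>c f x. c *\<^sub>C f x"
  by (simp add: bounded_clinear_def bounded_linear_compose[OF bounded_linear_scaleC]
      scaleC_scaleC mult.commute)

definition dist_cblinfun :: "'a \<Rightarrow>\<^sub>C\<^sub>L 'b \<Rightarrow> 'a \<Rightarrow>\<^sub>C\<^sub>L 'b \<Rightarrow> real"
  where "dist_cblinfun f g = norm (f - g)"

definition uniformity_cblinfun :: "(('a \<Rightarrow>\<^sub>C\<^sub>L 'b) \<times> ('a \<Rightarrow>\<^sub>C\<^sub>L 'b)) filter"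
  where "uniformity_cblinfun = (INF e\<in>{0<..}. principal {(f, g). dist f g < e})"

definition open_cblinfun :: "('a \<Rightarrow>\<^sub>C\<^sub>L 'b) set \<Rightarrow> bool"
  where "open_cblinfun S = (\<forall>f\<in>S. \<forall>\<^sub>F (f', g) in uniformity. f' = f \<longrightarrow> g \<in> S)"

definition sgn_cblinfun :: "'a \<Rightarrow>\<^sub>C\<^sub>L 'b \<Rightarrow> 'a \<Rightarrow>\<^sub>C\<^sub>L 'b"
  where "sgn_cblinfun f = inverse (norm f) *\<^sub>R f"

instance
  apply standard
  unfolding dist_cblinfun_def open_cblinfun_def sgn_cblinfun_def uniformity_cblinfun_def
  apply (rule refl | (transfer, force simp: bounded_clinear_def onorm_triangle onorm_scaleR
        onorm_scaleC onorm_eq_0 algebra_simps scaleC_add_right scaleC_add_left scaleC_scaleC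
        scaleC_of_real))+
  done

end

lemma norm_cblinfun: "norm (cblinfun_apply f x) \<le> norm f * norm x"
  by transfer (simp add: bounded_clinear_def onorm)

lemma norm_cblinfun_bound:
  "0 \<le> K \<Longrightarrow> (\<And>x. norm (cblinfun_apply f x) \<le> K * norm x) \<Longrightarrow> norm f \<le> K"
  by transfer (rule onorm_bound)

lemma cblinfun_apply_add_right: "cblinfun_apply f (x + y) = cblinfun_apply f x + cblinfun_apply f y"
  by transfer (simp add: bounded_clinear_def linear_simps)

lemma cblinfun_apply_scaleC_right: "cblinfun_apply f (c *\<^sub>C x) = c *\<^sub>C cblinfun_apply f x"
  by transfer (simp add: bounded_clinear_def)

lemmas cblinfun_apply_left = plus_cblinfun.rep_eq scaleC_cblinfun.rep_eq

lift_definition cblinfun_compose ::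
  "'b::complex_normed_vector \<Rightarrow>\<^sub>C\<^sub>L 'c::complex_normed_vector \<Rightarrow> 'a::complex_normed_vector \<Rightarrow>\<^sub>C\<^sub>L 'b \<Rightarrow> 'a \<Rightarrow>\<^sub>C\<^sub>L 'c"
  (infixl \<open>o\<^sub>C\<^sub>L\<close> 67) is "\<lambda>f g x. f (g x)"
  by (simp add: bounded_clinear_def bounded_linear_compose)

lemma norm_cblinfun_compose: "norm (f o\<^sub>C\<^sub>L g) \<le> norm f * norm g"
proof (rule norm_cblinfun_bound)
  fix x
  have "norm (f (g x)) \<le> norm f * (norm g * norm x)"
    by (rule order_trans[OF norm_cblinfun]) (simp add: norm_cblinfun mult_left_mono)
  then show "norm ((f o\<^sub>C\<^sub>L g) x) \<le> norm f * norm g * norm x"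
    by (simp add: cblinfun_compose.rep_eq mult.assoc)
qed simp

lemma cblinfun_compose_linear:
  "(f + g) o\<^sub>C\<^sub>L h = f o\<^sub>C\<^sub>L h + g o\<^sub>C\<^sub>L h" "f o\<^sub>C\<^sub>L (h + k) = f o\<^sub>C\<^sub>L h + f o\<^sub>C\<^sub>L k"
  "(c *\<^sub>C f) o\<^sub>C\<^sub>L h = c *\<^sub>C (f o\<^sub>C\<^sub>L h)" "f o\<^sub>C\<^sub>L (c *\<^sub>C h) = c *\<^sub>C (f o\<^sub>C\<^sub>L h)"
  by (rule cblinfun_eqI, simp add: cblinfun_compose.rep_eq cblinfun_apply_left
      cblinfun_apply_add_right cblinfun_apply_scaleC_right)+


section \<open>The bidual and the Arens product\<close>

type_synonym 'a dual = "'a \<Rightarrow>\<^sub>C\<^sub>L complex"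
type_synonym 'a bidual = "'a dual dual"
type_synonym 'h bop = "'h \<Rightarrow>\<^sub>C\<^sub>L 'h"

lift_definition bidual_embed :: "'a::complex_normed_vector \<Rightarrow> 'a bidual" is "\<lambda>x \<phi>. cblinfun_apply \<phi> x"
proof (rule bounded_clinearI)
  show "norm (cblinfun_apply \<phi> x) \<le> norm \<phi> * norm x" for \<phi> :: "'a dual" and x
    by (rule norm_cblinfun)
qed (simp_all add: cblinfun_apply_left)

text \<open>The Arens product on the bidual of the algebra of all bounded operators on a Hilbert space
  is obtained in three steps: \<open>(\<phi>\<cdot>S)(T) = \<phi>(ST)\<close>, \<open>(\<nu>\<cdot>\<phi>)(S) = \<nu>(\<phi>\<cdot>S)\<close> and
  \<open>(\<eta>\<nu>)(\<phi>) = \<eta>(\<nu>\<cdot>\<phi>)\<close>. This is the first Arens product; the two Arens products agree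
  on the bidual of a C*-algebra.\<close>

lift_definition arens_dual_op ::
  "('h::complex_hilbert_space) bop dual \<Rightarrow> 'h bop \<Rightarrow> 'h bop dual"
  is "\<lambda>\<phi> S T. cblinfun_apply \<phi> (S o\<^sub>C\<^sub>L T)"
proof (rule bounded_clinearI)
  fix \<phi> :: "'h bop dual" and S T :: "'h bop"
  have "norm (\<phi> (S o\<^sub>C\<^sub>L T)) \<le> norm \<phi> * (norm S * norm T)"
    by (rule order_trans[OF norm_cblinfun]) (simp add: norm_cblinfun_compose mult_left_mono)
  then show "norm (\<phi> (S o\<^sub>C\<^sub>L T)) \<le> norm T * (norm \<phi> * norm S)"
    by (simp add: mult_ac)
qed (simp_all add: cblinfun_compose_linear cblinfun_apply_add_right cblinfun_apply_scaleC_right)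

lemma norm_arens_dual_op: "norm (arens_dual_op \<phi> S) \<le> norm \<phi> * norm S"
proof (rule norm_cblinfun_bound)
  fix T
  have "norm (\<phi> (S o\<^sub>C\<^sub>L T)) \<le> norm \<phi> * (norm S * norm T)"
    by (rule order_trans[OF norm_cblinfun]) (simp add: norm_cblinfun_compose mult_left_mono)
  then show "norm (arens_dual_op \<phi> S T) \<le> norm \<phi> * norm S * norm T"
    by (simp add: arens_dual_op.rep_eq mult.assoc)
qed simp

lemma arens_dual_op_linear:
  "arens_dual_op (\<phi> + \<psi>) S = arens_dual_op \<phi> S + arens_dual_op \<psi> S"
  "arens_dual_op \<phi> (S + T) = arens_dual_op \<phi> S + arens_dual_op \<phi> T"
  "arens_dual_op (c *\<^sub>C \<phi>) S = c *\<^sub>C arens_dual_op \<phi> S"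
  "arens_dual_op \<phi> (c *\<^sub>C S) = c *\<^sub>C arens_dual_op \<phi> S"
  by (rule cblinfun_eqI, simp add: arens_dual_op.rep_eq cblinfun_apply_left cblinfun_compose_linear
      cblinfun_apply_add_right cblinfun_apply_scaleC_right)+

lift_definition arens_bidual_dual ::
  "('h::complex_hilbert_space) bop bidual \<Rightarrow> 'h bop dual \<Rightarrow> 'h bop dual"
  is "\<lambda>\<nu> \<phi> S. cblinfun_apply \<nu> (arens_dual_op \<phi> S)"
proof (rule bounded_clinearI)
  fix \<nu> :: "'h bop bidual" and \<phi> S
  have "norm (\<nu> (arens_dual_op \<phi> S)) \<le> norm \<nu> * (norm \<phi> * norm S)"
    by (rule order_trans[OF norm_cblinfun]) (simp add: norm_arens_dual_op mult_left_mono)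
  then show "norm (\<nu> (arens_dual_op \<phi> S)) \<le> norm S * (norm \<nu> * norm \<phi>)"
    by (simp add: mult_ac)
qed (simp_all add: arens_dual_op_linear cblinfun_apply_add_right cblinfun_apply_scaleC_right)

lemma norm_arens_bidual_dual: "norm (arens_bidual_dual \<nu> \<phi>) \<le> norm \<nu> * norm \<phi>"
proof (rule norm_cblinfun_bound)
  fix S
  have "norm (\<nu> (arens_dual_op \<phi> S)) \<le> norm \<nu> * (norm \<phi> * norm S)"
    by (rule order_trans[OF norm_cblinfun]) (simp add: norm_arens_dual_op mult_left_mono)
  then show "norm (arens_bidual_dual \<nu> \<phi> S) \<le> norm \<nu> * norm \<phi> * norm S"
    by (simp add: arens_bidual_dual.rep_eq mult.assoc)
qed simp

lift_definition arens ::
  "('h::complex_hilbert_space) bop bidual \<Rightarrow> 'h bop bidual \<Rightarrow> 'h bop bidual"  (infixl \<open>\<cdot>\<^sub>A\<close> 70)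
  is "\<lambda>\<eta> \<nu> \<phi>. cblinfun_apply \<eta> (arens_bidual_dual \<nu> \<phi>)"
proof (rule bounded_clinearI)
  fix \<eta> \<nu> :: "'h bop bidual" and \<phi> \<psi> :: "'h bop dual" and c
  have "arens_bidual_dual \<nu> (\<phi> + \<psi>) = arens_bidual_dual \<nu> \<phi> + arens_bidual_dual \<nu> \<psi>"
    by (rule cblinfun_eqI) (simp add: arens_bidual_dual.rep_eq arens_dual_op_linear
        cblinfun_apply_left cblinfun_apply_add_right)
  then show "\<eta> (arens_bidual_dual \<nu> (\<phi> + \<psi>))
      = \<eta> (arens_bidual_dual \<nu> \<phi>) + \<eta> (arens_bidual_dual \<nu> \<psi>)"
    by (simp add: cblinfun_apply_add_right)
  have "arens_bidual_dual \<nu> (c *\<^sub>C \<phi>) = c *\<^sub>C arens_bidual_dual \<nu> \<phi>"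
    by (rule cblinfun_eqI) (simp add: arens_bidual_dual.rep_eq arens_dual_op_linear
        cblinfun_apply_left cblinfun_apply_scaleC_right)
  then show "\<eta> (arens_bidual_dual \<nu> (c *\<^sub>C \<phi>)) = c *\<^sub>C \<eta> (arens_bidual_dual \<nu> \<phi>)"
    by (simp add: cblinfun_apply_scaleC_right)
  have "norm (\<eta> (arens_bidual_dual \<nu> \<phi>)) \<le> norm \<eta> * (norm \<nu> * norm \<phi>)"
    by (rule order_trans[OF norm_cblinfun]) (simp add: norm_arens_bidual_dual mult_left_mono)
  then show "norm (\<eta> (arens_bidual_dual \<nu> \<phi>)) \<le> norm \<phi> * (norm \<eta> * norm \<nu>)"
    by (simp add: mult_ac)
qed

lemma arens_bidual_embed: "bidual_embed S \<cdot>\<^sub>A bidual_embed T = bidual_embed (S o\<^sub>C\<^sub>L T)"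
  by (rule cblinfun_eqI)
    (simp add: arens.rep_eq bidual_embed.rep_eq arens_bidual_dual.rep_eq arens_dual_op.rep_eq)


section \<open>Adjoints and the involution on the bidual\<close>

lemma riesz_representation_real:
  fixes f :: "'a::{real_inner, complete_space} \<Rightarrow> real"
  assumes f: "bounded_linear f"
  shows "\<exists>z. \<forall>x. f x = inner z x"
proof -
  interpret f: bounded_linear f by fact
  define g where "g x = inner x x - 2 * f x" for x
  define m where "m = (INF x. g x)"
  have lower: "- (onorm f)\<^sup>2 \<le> g x" for x
  proof -
    have "f x \<le> onorm f * norm x"
      using onorm[OF f, of x] by simp
    moreover have "0 \<le> (norm x - onorm f)\<^sup>2"
      by simp
    ultimately show ?thesis
      by (simp add: g_def power2_norm_eq_inner[symmetric] power2_diff algebra_simps)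
  qed
  then have bdd: "bdd_below (range g)"
    by (auto intro!: bdd_belowI2)
  have m: "m \<le> g x" for x
    unfolding m_def by (rule cINF_lower[OF bdd]) simp
  have "\<exists>x. g x < m + 1 / real (Suc n)" for n
    using cINF_less_iff[OF _ bdd, of "m + 1 / real (Suc n)"] by (simp add: m_def)
  then obtain X where X: "\<And>n. g (X n) < m + 1 / real (Suc n)"
    by metis
  have para: "(norm (x - y))\<^sup>2 = 2 * (g x + g y - 2 * g ((1/2) *\<^sub>R (x + y)))" for x y
    by (simp add: g_def power2_norm_eq_inner inner_simps f.add f.scaleR inner_commute algebra_simps)
  have close: "(norm (X k - X n))\<^sup>2 \<le> 4 / real (Suc N)" if "N \<le> k" "N \<le> n" for N k n
  proof -
    have "1 / real (Suc k) \<le> 1 / real (Suc N)" "1 / real (Suc n) \<le> 1 / real (Suc N)"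
      using that by (simp_all add: frac_le)
    then have "g (X k) + g (X n) - 2 * g ((1/2) *\<^sub>R (X k + X n)) \<le> 2 * (1 / real (Suc N))"
      using X[of k] X[of n] m[of "(1/2) *\<^sub>R (X k + X n)"] by argo
    then show ?thesis
      using para[of "X k" "X n"] by simp
  qed
  have "Cauchy X"
  proof (rule metric_CauchyI)
    fix e :: real assume e: "0 < e"
    then obtain N where N: "4 / e\<^sup>2 < real N"
      using reals_Archimedean2 by blast
    have "4 / real (Suc N) < e\<^sup>2"
    proof -
      have "4 < real N * e\<^sup>2"
        using N e by (simp add: divide_less_eq)
      also have "\<dots> \<le> real (Suc N) * e\<^sup>2"
        by (intro mult_right_mono) simp_all
      finally show ?thesis
        by (simp add: divide_less_eq mult.commute)
    qed
    then have "dist (X k) (X n) < e" if "N \<le> k" "N \<le> n" for k n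
      using power_less_imp_less_base[OF order_le_less_trans[OF close[OF that]], of e] e
      by (simp add: dist_norm)
    then show "\<exists>N. \<forall>k\<ge>N. \<forall>n\<ge>N. dist (X k) (X n) < e"
      by blast
  qed
  then obtain z where z: "X \<longlonglongrightarrow> z"
    using Cauchy_convergent convergent_def by blast
  have "(\<lambda>n. g (X n)) \<longlonglongrightarrow> g z"
    unfolding g_def by (intro tendsto_intros z f.tendsto)
  moreover have "(\<lambda>n. m + 1 / real (Suc n)) \<longlonglongrightarrow> m"
    using tendsto_add[OF tendsto_const LIMSEQ_inverse_real_of_nat, of m] by (simp add: field_simps)
  ultimately have gz: "g z \<le> m"
    using X by (intro LIMSEQ_le) (auto intro: less_imp_le)
  have "f x = inner z x" for x
  proof (rule ccontr)
    assume neq: "f x \<noteq> inner z x"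
    define d where "d = inner z x - f x"
    define t where "t = - d / (inner x x + 1)"
    have pos: "inner x x + 1 > 0"
      by (simp add: add_nonneg_pos)
    have d: "d\<^sup>2 > 0"
      using neq by (simp add: d_def)
    have "g (z + t *\<^sub>R x) = g z + 2 * t * d + t\<^sup>2 * inner x x"
      by (simp add: g_def d_def inner_simps f.add f.scaleR inner_commute power2_eq_square algebra_simps)
    also have "\<dots> \<le> g z + 2 * t * d + t\<^sup>2 * (inner x x + 1)"
      by (simp add: algebra_simps)
    also have "\<dots> = g z - d\<^sup>2 / (inner x x + 1)"
    proof -
      have "t * (inner x x + 1) = - d"
        using pos by (simp add: t_def)
      then have "t\<^sup>2 * (inner x x + 1) = - (t * d)"
        by (simp add: power2_eq_square mult.assoc)
      moreover have "d\<^sup>2 / (inner x x + 1) = - (t * d)"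
        by (simp add: t_def power2_eq_square)
      ultimately show ?thesis
        by simp
    qed
    also have "\<dots> < g z"
      using d pos by simp
    finally show False
      using m[of "z + t *\<^sub>R x"] gz by linarith
  qed
  then show ?thesis
    by blast
qed

lemma cinner_scaleC_left:
  "cinner (c *\<^sub>C x) y = cnj c * cinner x (y::'a::complex_hilbert_space)"
  by (subst (1 2) cinner_commute) (simp add: cinner_scaleC_right)

lemma cinner_add_left:
  "cinner (x + y) z = cinner x z + cinner y (z::'a::complex_hilbert_space)"
  by (subst (1 2 3) cinner_commute) (simp add: cinner_add_right)

lemma cinner_eq_inner:
  "cinner x y = Complex (inner x y) (inner (\<i> *\<^sub>C x) (y::'a::complex_hilbert_space))"
  by (simp add: complex_eq_iff inner_eq_Re_cinner cinner_scaleC_left)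

lemma cinner_eqI:
  fixes x y :: "'a::complex_hilbert_space"
  assumes "\<And>z. cinner z x = cinner z y"
  shows "x = y"
proof -
  have "inner (x - y) x = inner (x - y) y"
    by (simp add: inner_eq_Re_cinner assms)
  then have "inner (x - y) (x - y) = 0"
    by (simp add: inner_diff_right)
  then show ?thesis
    by simp
qed

definition cadjoint :: "('h::complex_hilbert_space) bop \<Rightarrow> 'h bop"
  where "cadjoint T = (THE S::'h bop. \<forall>x y. cinner (T x) y = cinner x (S y))"

lemma cadjoint_exists:
  fixes T :: "('h::complex_hilbert_space) bop"
  shows "\<exists>S::'h bop. \<forall>x y. cinner (T x) y = cinner x (S y)"
proof -
  have T: "bounded_linear (cblinfun_apply T)"
    using cblinfun_apply[of T] by (simp add: bounded_clinear_def)
  have "\<exists>z. \<forall>x. inner y (T x) = inner z x" for y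
    by (rule riesz_representation_real)
      (rule bounded_linear_compose[OF bounded_linear_inner_right T])
  then obtain S where S: "\<And>x y. inner y (T x) = inner (S y) x"
    by metis
  have cS: "cinner (T x) y = cinner x (S y)" for x y
  proof -
    have "inner (T x) y = inner x (S y)" for x
      using S by (simp add: inner_commute)
    then show ?thesis
      by (simp add: cinner_eq_inner cblinfun_apply_scaleC_right[symmetric])
  qed
  have "bounded_clinear S"
  proof (rule bounded_clinearI)
    show "S (x + y) = S x + S y" for x y
      by (rule cinner_eqI) (simp add: cS[symmetric] cinner_add_right)
    show "S (c *\<^sub>C x) = c *\<^sub>C S x" for c x
      by (rule cinner_eqI) (simp add: cS[symmetric] cinner_scaleC_right)
    show "norm (S y) \<le> norm y * norm T" for y
    proof -
      have "(norm (S y))\<^sup>2 = inner y (T (S y))"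
        by (simp add: S power2_norm_eq_inner)
      also have "\<dots> \<le> norm y * norm (T (S y))"
        by (rule norm_cauchy_schwarz)
      also have "\<dots> \<le> norm y * (norm T * norm (S y))"
        by (simp add: norm_cblinfun mult_left_mono)
      finally have "norm (S y) * norm (S y) \<le> (norm y * norm T) * norm (S y)"
        by (simp add: power2_eq_square mult.assoc)
      then show ?thesis
        by (cases "norm (S y) = 0") (simp_all add: mult_le_cancel_right)
    qed
  qed
  then have "\<forall>x y. cinner (T x) y = cinner x (CBlinfun S y)"
    using cS by (simp add: CBlinfun_inverse)
  then show ?thesis
    by blast
qed

lemma cadjoint: "cinner (cblinfun_apply T x) y = cinner x (cadjoint T y)"
proof -
  obtain S :: "'a bop" where S: "\<forall>x y. cinner (T x) y = cinner x (S y)"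
    using cadjoint_exists by blast
  have "cadjoint T = S"
    unfolding cadjoint_def
  proof (rule the_equality)
    show "\<forall>x y. cinner (T x) y = cinner x (S y)"
      by (rule S)
    fix S' :: "'a bop" assume S': "\<forall>x y. cinner (T x) y = cinner x (S' y)"
    show "S' = S"
      by (intro cblinfun_eqI cinner_eqI) (simp only: S[rule_format, symmetric] S'[rule_format, symmetric])
  qed
  then show ?thesis
    using S by simp
qed

lemma cadjoint_add: "cadjoint (S + T) = cadjoint S + cadjoint T"
  by (intro cblinfun_eqI cinner_eqI)
    (simp add: cadjoint[symmetric] cinner_add_left cinner_add_right cblinfun_apply_left)

lemma cadjoint_scaleC: "cadjoint (c *\<^sub>C T) = cnj c *\<^sub>C cadjoint T"
  by (intro cblinfun_eqI cinner_eqI)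
    (simp add: cadjoint[symmetric] cinner_scaleC_left cinner_scaleC_right cblinfun_apply_left)

lemma norm_cadjoint: "norm (cadjoint T) \<le> norm T"
proof (rule norm_cblinfun_bound)
  fix y
  let ?z = "cadjoint T y"
  have "(norm ?z)\<^sup>2 = inner (T ?z) y"
    by (simp add: inner_eq_Re_cinner power2_norm_eq_inner cadjoint)
  also have "\<dots> \<le> norm (T ?z) * norm y"
    by (rule norm_cauchy_schwarz)
  also have "\<dots> \<le> (norm T * norm ?z) * norm y"
    by (simp add: norm_cblinfun mult_right_mono)
  finally have "norm ?z * norm ?z \<le> (norm T * norm y) * norm ?z"
    by (simp add: power2_eq_square mult_ac)
  then show "norm ?z \<le> norm T * norm y"
    by (cases "norm ?z = 0") (simp_all add: mult_le_cancel_right)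
qed simp

text \<open>The involution of the bidual: \<open>\<phi>\<^sup>*(T) = cnj (\<phi>(T\<^sup>*))\<close> on the dual, and
  \<open>\<eta>\<^sup>*(\<phi>) = cnj (\<eta>(\<phi>\<^sup>*))\<close> on the bidual.\<close>

lift_definition dual_star :: "('h::complex_hilbert_space) bop dual \<Rightarrow> 'h bop dual"
  is "\<lambda>\<phi> T. cnj (cblinfun_apply \<phi> (cadjoint T))"
proof (rule bounded_clinearI)
  fix \<phi> :: "'h bop dual" and T :: "'h bop"
  have "norm (\<phi> (cadjoint T)) \<le> norm \<phi> * norm T"
    by (rule order_trans[OF norm_cblinfun]) (simp add: norm_cadjoint mult_left_mono)
  then show "norm (cnj (\<phi> (cadjoint T))) \<le> norm T * norm \<phi>"
    by (simp add: mult.commute)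
qed (simp_all add: cadjoint_add cadjoint_scaleC cblinfun_apply_add_right
    cblinfun_apply_scaleC_right scaleC_complex_def)

lift_definition bidual_star :: "('h::complex_hilbert_space) bop bidual \<Rightarrow> 'h bop bidual"
  is "\<lambda>\<eta> \<phi>. cnj (cblinfun_apply \<eta> (dual_star \<phi>))"
proof (rule bounded_clinearI)
  fix \<eta> :: "'h bop bidual" and \<phi> \<psi> :: "'h bop dual" and c
  have "dual_star (\<phi> + \<psi>) = dual_star \<phi> + dual_star \<psi>"
    by (rule cblinfun_eqI) (simp add: dual_star.rep_eq cblinfun_apply_left)
  then show "cnj (\<eta> (dual_star (\<phi> + \<psi>))) = cnj (\<eta> (dual_star \<phi>)) + cnj (\<eta> (dual_star \<psi>))"
    by (simp add: cblinfun_apply_add_right)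
  have "dual_star (c *\<^sub>C \<phi>) = cnj c *\<^sub>C dual_star \<phi>"
    by (rule cblinfun_eqI) (simp add: dual_star.rep_eq cblinfun_apply_left scaleC_complex_def)
  then show "cnj (\<eta> (dual_star (c *\<^sub>C \<phi>))) = c *\<^sub>C cnj (\<eta> (dual_star \<phi>))"
    by (simp add: cblinfun_apply_scaleC_right scaleC_complex_def)
  have "norm (dual_star \<phi>) \<le> norm \<phi>"
  proof (rule norm_cblinfun_bound)
    fix T
    have "norm (\<phi> (cadjoint T)) \<le> norm \<phi> * norm T"
      by (rule order_trans[OF norm_cblinfun]) (simp add: norm_cadjoint mult_left_mono)
    then show "norm (dual_star \<phi> T) \<le> norm \<phi> * norm T"
      by (simp add: dual_star.rep_eq)
  qed simp
  then have "norm (\<eta> (dual_star \<phi>)) \<le> norm \<eta> * norm \<phi>"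
    by (intro order_trans[OF norm_cblinfun]) (simp add: mult_left_mono)
  then show "norm (cnj (\<eta> (dual_star \<phi>))) \<le> norm \<phi> * norm \<eta>"
    by (simp add: mult.commute)
qed

lemma bidual_star_embed: "bidual_star (bidual_embed T) = bidual_embed (cadjoint T)"
  by (rule cblinfun_eqI) (simp add: bidual_star.rep_eq bidual_embed.rep_eq dual_star.rep_eq)


section \<open>Operator algebras and open projections\<close>

definition operator_algebra :: "('h::complex_hilbert_space) bop set \<Rightarrow> bool"
  where "operator_algebra A \<longleftrightarrow>
    0 \<in> A \<and> (\<forall>S\<in>A. \<forall>T\<in>A. S + T \<in> A) \<and> (\<forall>c. \<forall>S\<in>A. c *\<^sub>C S \<in> A) \<and>
    (\<forall>S\<in>A. \<forall>T\<in>A. S o\<^sub>C\<^sub>L T \<in> A) \<and> closed A"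

text \<open>The bidual of \<open>A\<close>, realised as the bipolar \<open>A\<^sup>\<bottom>\<^sup>\<bottom>\<close> inside the bidual of the C*-algebra of
  all bounded operators; product and involution are those of the latter.\<close>

definition alg_bidual :: "('h::complex_hilbert_space) bop set \<Rightarrow> 'h bop bidual set"
  where "alg_bidual A = {\<eta>. \<forall>\<phi>. (\<forall>a\<in>A. cblinfun_apply \<phi> a = 0) \<longrightarrow> cblinfun_apply \<eta> \<phi> = 0}"

definition projection :: "('h::complex_hilbert_space) bop bidual \<Rightarrow> bool"
  where "projection p \<longleftrightarrow> p \<cdot>\<^sub>A p = p \<and> bidual_star p = p"

text \<open>Nets in \<open>A\<close> are expressed by proper filters; the last conjunct is weak* convergence of the
  net to \<open>p\<close>. By the Hahn-Banach theorem, the functionals on \<open>A\<close> are the restrictions of those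
  on the algebra of all bounded operators, so it does not matter which are used for testing.\<close>

definition open_projection ::
    "('h::complex_hilbert_space) bop set \<Rightarrow> 'h bop bidual \<Rightarrow> bool"
  where "open_projection A p \<longleftrightarrow> projection p \<and> p \<in> alg_bidual A \<and>
    (\<exists>F::'h bop filter. F \<noteq> bot \<and>
      (\<forall>\<^sub>F x in F. x \<in> A \<and> bidual_embed x = p \<cdot>\<^sub>A bidual_embed x) \<and>
      (\<forall>\<phi>. ((\<lambda>x. cblinfun_apply (bidual_embed x) \<phi>) \<longlongrightarrow> cblinfun_apply p \<phi>) F))"

definition ell_ideal :: "('h::complex_hilbert_space) bop set \<Rightarrow> 'h bop bidual \<Rightarrow> 'h bop set"
  where "ell_ideal A p = {a \<in> A. bidual_embed a \<cdot>\<^sub>A p = bidual_embed a}"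

end

theory Submission
  imports Defs
begin

text \<open>
  Put \<open>q = 1 - p\<close>. Every \<open>y\<close> in the ideal satisfies \<open>(b - y)q = bq\<close>, so the distance \<open>d\<close> is at least
  \<open>\<parallel>bq\<parallel>\<close>, and it suffices to find \<open>x\<close> in the ideal with \<open>\<parallel>b - x\<parallel> \<le> d\<close>. Since \<open>b\<close> commutes with \<open>p\<close>,
  the element \<open>b - \<delta>bp = bq + (1 - \<delta>)bp\<close> of the bidual is block diagonal, and its norm is the maximum of
  those of the blocks. If \<open>\<parallel>b\<parallel> \<le> d + \<epsilon>\<close>, then \<open>\<delta> = \<epsilon> / (d + \<epsilon>)\<close> brings this norm down to \<open>d\<close>, at the
  cost of a change by at most \<open>\<epsilon>\<close>. Replacing \<open>p\<close> by an element \<open>e\<close> of the algebra with \<open>e = pe = ep\<close> that approximates it, one gets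
  \<open>\<parallel>b - \<delta>be\<parallel> \<le> d + \<tau>\<close> for any \<open>\<tau> > 0\<close>, while \<open>b - \<delta>be\<close> still commutes with \<open>p\<close> and has the same product
  with \<open>q\<close>. Iterating with \<open>\<epsilon>\<close> decreasing geometrically gives a norm convergent sequence of corrections
  (\<open>D_correction\<close>, \<open>successive_correction\<close>).

  Approximation is the Hahn-Banach theorem: for \<open>\<eta>\<close> in the bipolar of a subspace \<open>R\<close>, some \<open>r \<in> R\<close>
  makes \<open>\<parallel>u - r\<parallel>\<close> and \<open>\<parallel>v - br\<parallel>\<close> simultaneously almost as small as \<open>\<parallel>u - \<eta>\<parallel>\<close> and \<open>\<parallel>v - b\<eta>\<parallel>\<close>
  (\<open>bipolar_approximation\<close>). Openness says that \<open>p\<close> lies in the bipolar of the right ideal of those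
  \<open>x \<in> A\<close> with \<open>x = px\<close>, but the elements \<open>e\<close> needed above must also satisfy \<open>e = ep\<close>. This comes from
  the geometry of contractions: if \<open>e = pe\<close> and \<open>\<parallel>1 - e\<parallel> \<le> 1\<close>, then the column
  \<open>(1 - e)q = q - eq\<close> is a contraction with entries \<open>q\<close> and \<open>- eq\<close>, and the entry \<open>q\<close> leaves no room for
  the other one: \<open>eq = 0\<close>. In quantitative form, \<open>\<parallel>1 - e\<parallel> \<le> 1 + \<epsilon>\<close> with \<open>\<epsilon> \<le> 1\<close> forces
  \<open>\<parallel>eq\<parallel> \<le> 2\<surd>\<epsilon>\<close>; so there is a nearby point of the bipolar, with
  \<open>eq\<close> removed and the diagonal block slightly shrunk, for which the norm is at most \<open>1\<close>, and a second
  successive approximation reaches \<open>\<parallel>1 - e\<parallel> \<le> 1\<close> exactly (\<open>R_correction\<close>, \<open>R_near_contraction\<close>).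

  These norm computations need the bidual of \<open>B(H)\<close> to be a C*-algebra. A functional of
  norm at most one is dominated by a positive functional \<open>\<psi>\<close>
  (\<open>functional_dominated\<close>), and an approximate form of the Riesz theorem for the semi-inner product
  \<open>\<psi>(S\<^sup>*T)\<close> replaces elements of the bidual, acting on the cyclic vector, by operators, up to a small
  error. This gives \<open>(\<eta>\<nu>)\<^sup>* = \<nu>\<^sup>*\<eta>\<^sup>*\<close>, positivity of \<open>\<eta>\<^sup>*\<eta>\<close> and the C*-inequality
  (\<open>bidual_star_arens\<close>, \<open>arens_star_square_nonneg\<close>, \<open>cstar_inequality\<close>).
\<close>

section \<open>The Hahn-Banach theorem\<close>

text \<open>The usual extension by one dimension, for a partial functional given by its graph \<open>G\<close>: the
  value \<open>s\<close> at the new vector \<open>x\<close> must lie above all \<open>r - N (y - x)\<close> and below all \<open>N (y + x) - r\<close>,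
  and subadditivity leaves room between them.\<close>

lemma hahn_banach_one_step:
  fixes N :: "'v::real_vector \<Rightarrow> real"
  assumes subadd: "\<And>x y. N (x + y) \<le> N x + N y"
    and homog: "\<And>x t. 0 < t \<Longrightarrow> N (t *\<^sub>R x) = t * N x"
    and G: "subspace G" and le: "\<And>y r. (y, r) \<in> G \<Longrightarrow> r \<le> N y"
  obtains s where "\<And>y r t. (y, r) \<in> G \<Longrightarrow> r + t * s \<le> N (y + t *\<^sub>R x)"
proof -
  define L where "L = (\<lambda>(y, r). r - N (y - x)) ` G"
  define s where "s = Sup L"
  have 0: "(0, 0) \<in> G"
    using subspace_0[OF G] by (simp add: zero_prod_def)
  have key: "r - N (y - x) \<le> N (y' + x) - r'" if "(y, r) \<in> G" "(y', r') \<in> G" for y r y' r'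
  proof -
    have "(y + y', r + r') \<in> G"
      using subspace_add[OF G that] by simp
    then have "r + r' \<le> N ((y - x) + (y' + x))"
      using le by (simp add: algebra_simps)
    then show ?thesis
      using subadd[of "y - x" "y' + x"] by linarith
  qed
  have ne: "L \<noteq> {}"
    using 0 by (auto simp: L_def)
  have bdd: "bdd_above L"
    unfolding L_def using key[OF _ 0] by (intro bdd_aboveI2[where M = "N (0 + x) - 0"]) auto
  have lower: "r - N (y - x) \<le> s" if "(y, r) \<in> G" for y r
    unfolding s_def by (rule cSup_upper[OF _ bdd]) (use that in \<open>auto simp: L_def\<close>)
  have upper: "s \<le> N (y + x) - r" if "(y, r) \<in> G" for y r
    unfolding s_def by (rule cSup_least[OF ne]) (use key[OF _ that] in \<open>auto simp: L_def\<close>)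
  show ?thesis
  proof
    fix y and r t :: real assume yr: "(y, r) \<in> G"
    have scaled: "(c *\<^sub>R y, c * r) \<in> G" for c
      using subspace_scale[OF G yr, of c] by simp
    consider "t = 0" | "t > 0" | "t < 0"
      by linarith
    then show "r + t * s \<le> N (y + t *\<^sub>R x)"
    proof cases
      case 1
      then show ?thesis using le[OF yr] by simp
    next
      case 2
      have "s \<le> N ((1 / t) *\<^sub>R y + x) - (1 / t) * r"
        by (rule upper[OF scaled])
      then have "t * s \<le> t * N ((1 / t) *\<^sub>R y + x) - r"
        using 2 by (simp add: field_simps)
      also have "t * N ((1 / t) *\<^sub>R y + x) = N (y + t *\<^sub>R x)"
        using 2 by (simp add: homog[symmetric] scaleR_add_right)
      finally show ?thesis by simp
    next
      case 3
      have "(1 / (- t)) * r - N ((1 / (- t)) *\<^sub>R y - x) \<le> s"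
        by (rule lower[OF scaled])
      then have "(- t) * ((1 / (- t)) * r - N ((1 / (- t)) *\<^sub>R y - x)) \<le> (- t) * s"
        using 3 by (intro mult_left_mono) auto
      then have "r - (- t) * N ((1 / (- t)) *\<^sub>R y - x) \<le> (- t) * s"
        using 3 by (simp add: right_diff_distrib)
      also have "(- t) * N ((1 / (- t)) *\<^sub>R y - x) = N ((- t) *\<^sub>R ((1 / (- t)) *\<^sub>R y - x))"
        using 3 by (simp only: homog)
      also have "(- t) *\<^sub>R ((1 / (- t)) *\<^sub>R y - x) = y + t *\<^sub>R x"
        using 3 by (simp add: scaleR_diff_right)
      finally show ?thesis by simp
    qed
  qed
qed

text \<open>Partial functionals are encoded by their graphs, subspaces of \<open>'v \<times> real\<close>, so that extension is
  inclusion and Zorn's lemma applies to sets.\<close>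

lemma hahn_banach:
  fixes N :: "'v::real_vector \<Rightarrow> real"
  assumes subadd: "\<And>x y. N (x + y) \<le> N x + N y"
    and homog: "\<And>x t. 0 < t \<Longrightarrow> N (t *\<^sub>R x) = t * N x"
    and G0: "subspace G0" and le0: "\<And>x r. (x, r) \<in> G0 \<Longrightarrow> r \<le> N x"
  obtains g where "linear g" "\<And>x r. (x, r) \<in> G0 \<Longrightarrow> g x = r" "\<And>x. g x \<le> N x"
proof -
  define \<A> where "\<A> = {G. subspace G \<and> G0 \<subseteq> G \<and> (\<forall>(x, r)\<in>G. r \<le> N x)}"
  have "\<exists>M\<in>\<A>. \<forall>X\<in>\<A>. M \<subseteq> X \<longrightarrow> X = M"
  proof (rule subset_Zorn_nonempty)
    have "G0 \<in> \<A>"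
      using G0 le0 by (auto simp: \<A>_def)
    then show "\<A> \<noteq> {}" by blast
    fix \<C> assume ne: "\<C> \<noteq> {}" and chain: "subset.chain \<A> \<C>"
    then have sub: "subspace G" "G0 \<subseteq> G" "\<And>x r. (x, r) \<in> G \<Longrightarrow> r \<le> N x" if "G \<in> \<C>" for G
      using that by (auto simp: \<A>_def subset.chain_def)
    have "subspace (\<Union>\<C>)"
    proof (rule subspaceI)
      show "0 \<in> \<Union>\<C>"
        using ne sub(1) subspace_0 by blast
      show "c *\<^sub>R x \<in> \<Union>\<C>" if "x \<in> \<Union>\<C>" for c x
        using that sub(1) subspace_scale by blast
      show "x + y \<in> \<Union>\<C>" if xy: "x \<in> \<Union>\<C>" "y \<in> \<Union>\<C>" for x y
      proof -
        obtain G where "G \<in> \<C>" "x \<in> G" "y \<in> G"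
          using xy chain unfolding subset.chain_def by blast
        then show ?thesis
          using sub(1) subspace_add by blast
      qed
    qed
    then show "\<Union>\<C> \<in> \<A>"
      using ne sub unfolding \<A>_def by fast
  qed
  then obtain M where "M \<in> \<A>" and max: "\<And>X. X \<in> \<A> \<Longrightarrow> M \<subseteq> X \<Longrightarrow> X = M"
    by blast
  then have M: "subspace M" and G0M: "G0 \<subseteq> M" and le: "\<And>x r. (x, r) \<in> M \<Longrightarrow> r \<le> N x"
    by (auto simp: \<A>_def)
  have ex: "\<exists>r. (x, r) \<in> M" for x
  proof -
    obtain s where s: "\<And>y r t. (y, r) \<in> M \<Longrightarrow> r + t * s \<le> N (y + t *\<^sub>R x)"
      using hahn_banach_one_step[OF subadd homog M le, of x] by metis
    define M' where "M' = {a + b |a b. a \<in> M \<and> b \<in> span {(x, s)}}"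
    have "subspace M'"
      unfolding M'_def by (rule subspace_sums[OF M subspace_span])
    moreover have "M \<subseteq> M'"
    proof
      fix a assume "a \<in> M"
      then have "a + 0 \<in> M'"
        unfolding M'_def using span_zero by blast
      then show "a \<in> M'"
        by simp
    qed
    moreover have "r \<le> N y" if yr: "(y, r) \<in> M'" for y r
    proof -
      obtain a k where "a \<in> M" "(y, r) = a + k *\<^sub>R (x, s)"
        using yr unfolding M'_def span_singleton by blast
      then show ?thesis
        using s[of "fst a" "snd a" k] by (cases a) simp
    qed
    ultimately have "M' = M"
      using G0M by (intro max) (auto simp: \<A>_def)
    moreover have "0 + (x, s) \<in> M'"
      unfolding M'_def using subspace_0[OF M] span_base[of "(x, s)" "{(x, s)}"] by blast
    ultimately show ?thesis
      by auto
  qed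
  \<comment> \<open>Domination by \<open>N\<close> already makes the relation \<open>M\<close> single-valued.\<close>
  have uniq: "r = r'" if "(x, r) \<in> M" "(x, r') \<in> M" for x r r'
  proof -
    have N0: "N 0 = 0"
      using homog[of 2 0] by simp
    have "(0, r - r') \<in> M" "(0, r' - r) \<in> M"
      using subspace_diff[OF M that] subspace_diff[OF M that(2,1)] by simp_all
    then show ?thesis
      using le[of 0 "r - r'"] le[of 0 "r' - r"] N0 by simp
  qed
  define g where "g x = (THE r. (x, r) \<in> M)" for x
  have g: "(x, g x) \<in> M" for x
    unfolding g_def by (rule theI') (use ex uniq in blast)
  have geq: "g x = r" if "(x, r) \<in> M" for x r
    using uniq g that by blast
  show ?thesis
  proof
    show "linear g"
    proof (rule linearI)
      show "g (x + y) = g x + g y" for x y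
        using subspace_add[OF M g[of x] g[of y]] by (intro geq) simp
      show "g (c *\<^sub>R x) = c *\<^sub>R g x" for c x
        using subspace_scale[OF M g[of x], of c] by (intro geq) simp
    qed
    show "g x = r" if "(x, r) \<in> G0" for x r
      using that G0M geq by blast
    show "g x \<le> N x" for x
      using le g by blast
  qed
qed

section \<open>Functionals on a complex normed space\<close>

lemma cblinfun_apply_scaleR_right:
  "cblinfun_apply f (r *\<^sub>R x) = r *\<^sub>R cblinfun_apply f x"
  by (simp add: scaleC_of_real[symmetric] cblinfun_apply_scaleC_right)

lemma cblinfun_apply_zero_right [simp]: "cblinfun_apply f 0 = 0"
  using cblinfun_apply_scaleR_right[of f 0 0] by simp

lemma cblinfun_apply_minus_right: "cblinfun_apply f (- x) = - cblinfun_apply f x"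
  using cblinfun_apply_scaleR_right[of f "- 1" x] by simp

lemma cblinfun_apply_diff_right:
  "cblinfun_apply f (x - y) = cblinfun_apply f x - cblinfun_apply f y"
  using cblinfun_apply_add_right[of f x "- y"] by (simp add: cblinfun_apply_minus_right)

lemmas cblinfun_apply_right = cblinfun_apply_add_right cblinfun_apply_scaleC_right
  cblinfun_apply_scaleR_right cblinfun_apply_minus_right cblinfun_apply_diff_right

lemmas cblinfun_apply_ops = plus_cblinfun.rep_eq scaleC_cblinfun.rep_eq scaleR_cblinfun.rep_eq
  minus_cblinfun.rep_eq uminus_cblinfun.rep_eq zero_cblinfun.rep_eq

lemma Re_functional_phase:
  fixes \<phi> :: "'a::complex_normed_vector dual"
  obtains c where "cmod c = 1" "Re (cblinfun_apply \<phi> (c *\<^sub>C x)) = cmod (cblinfun_apply \<phi> x)"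
proof -
  let ?z = "cblinfun_apply \<phi> x"
  define c where "c = (if ?z = 0 then 1 else cnj ?z / cmod ?z)"
  have "cmod c = 1"
    by (simp add: c_def norm_divide)
  moreover have "c * ?z = cmod ?z"
    by (simp add: c_def complex_norm_square[symmetric] power2_eq_square mult.commute)
  ultimately show ?thesis
    by (intro that[of c]) (simp_all add: cblinfun_apply_right scaleC_complex_def)
qed

text \<open>A complex functional attains its modulus as a real part after a rotation of the argument, so
  bounds on real parts control the norm. This transfers one-sided real estimates, as they come
  out of the Hahn-Banach theorem, to norms of complex functionals.\<close>

lemma norm_functional_le:
  fixes \<phi> :: "'a::complex_normed_vector dual"
  assumes \<alpha>: "0 < \<alpha>" and le: "\<And>x. norm x \<le> \<alpha> \<Longrightarrow> Re (cblinfun_apply \<phi> x) \<le> k"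
  shows "\<alpha> * norm \<phi> \<le> k"
proof -
  have k: "0 \<le> k"
    using le[of 0] \<alpha> by simp
  have "norm \<phi> \<le> k / \<alpha>"
  proof (rule norm_cblinfun_bound)
    fix x
    show "norm (cblinfun_apply \<phi> x) \<le> k / \<alpha> * norm x"
    proof (cases "x = 0")
      case False
      obtain c where c: "cmod c = 1" "Re (cblinfun_apply \<phi> (c *\<^sub>C x)) = cmod (cblinfun_apply \<phi> x)"
        by (rule Re_functional_phase)
      have "Re (cblinfun_apply \<phi> ((\<alpha> / norm x) *\<^sub>R c *\<^sub>C x)) \<le> k"
        using \<alpha> False c by (intro le) (simp add: norm_scaleC)
      then have "(\<alpha> / norm x) * cmod (cblinfun_apply \<phi> x) \<le> k"
        by (simp only: cblinfun_apply_scaleR_right scaleR_complex.simps c)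
      then show ?thesis
        using \<alpha> False by (simp add: field_simps)
    qed simp
  qed (use k \<alpha> in simp)
  then show ?thesis
    using \<alpha> by (simp add: field_simps)
qed

lemma complexify_functional:
  fixes f :: "'a::complex_normed_vector \<Rightarrow> real"
  assumes f: "linear f" and le: "\<And>x. f x \<le> K * norm x"
  obtains \<phi> :: "'a dual" where "\<And>x. cblinfun_apply \<phi> x = Complex (f x) (- f (\<i> *\<^sub>C x))"
proof -
  define F where "F x = Complex (f x) (- f (\<i> *\<^sub>C x))" for x
  have ab: "\<bar>f x\<bar> \<le> K * norm x" for x
    using le[of x] le[of "- x"] by (simp add: linear_neg[OF f] abs_le_iff)
  have scale: "f (c *\<^sub>C x) = Re c * f x + Im c * f (\<i> *\<^sub>C x)" for c x
  proof -
    have "c *\<^sub>C x = Re c *\<^sub>R x + Im c *\<^sub>R \<i> *\<^sub>C x"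
      by (simp add: scaleC_of_real[symmetric] scaleC_scaleC scaleC_add_left[symmetric])
        (simp add: complex_eq[symmetric] mult.commute)
    then show ?thesis
      by (simp add: linear_add[OF f] linear_scale[OF f])
  qed
  have "bounded_clinear F"
  proof (rule bounded_clinearI)
    show "F (x + y) = F x + F y" for x y
      by (simp add: F_def linear_add[OF f] scaleC_add_right complex_eq_iff)
    show "F (c *\<^sub>C x) = c *\<^sub>C F x" for c x
      by (simp add: F_def scale[of c] scale[of "\<i> * c"] scaleC_scaleC complex_eq_iff
          scaleC_complex_def algebra_simps)
    fix x
    have "norm (F x) \<le> \<bar>f x\<bar> + \<bar>f (\<i> *\<^sub>C x)\<bar>"
      using cmod_le[of "F x"] by (simp add: F_def)
    also have "\<dots> \<le> K * norm x + K * norm (\<i> *\<^sub>C x)"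
      by (intro add_mono ab)
    finally show "norm (F x) \<le> norm x * (2 * K)"
      by (simp add: norm_scaleC algebra_simps)
  qed
  then show ?thesis
    by (intro that[of "CBlinfun F"]) (simp add: CBlinfun_inverse F_def)
qed

section \<open>The Banach algebra structure of the bidual\<close>

lift_definition id_op :: "'a::complex_normed_vector \<Rightarrow>\<^sub>C\<^sub>L 'a" is "\<lambda>x. x"
  by (simp add: bounded_clinear_def bounded_linear_ident)

lemma norm_id_op: "norm id_op \<le> 1"
  by (rule norm_cblinfun_bound) (simp_all add: id_op.rep_eq)

lemma cblinfun_compose_id [simp]: "id_op o\<^sub>C\<^sub>L T = T" "T o\<^sub>C\<^sub>L id_op = T"
  by (rule cblinfun_eqI, simp add: cblinfun_compose.rep_eq id_op.rep_eq)+

lemma cblinfun_compose_assoc: "(S o\<^sub>C\<^sub>L T) o\<^sub>C\<^sub>L U = S o\<^sub>C\<^sub>L (T o\<^sub>C\<^sub>L U)"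
  by (rule cblinfun_eqI) (simp add: cblinfun_compose.rep_eq)

lemma cblinfun_compose_diff:
  "(f - g) o\<^sub>C\<^sub>L h = f o\<^sub>C\<^sub>L h - g o\<^sub>C\<^sub>L h" "f o\<^sub>C\<^sub>L (h - k) = f o\<^sub>C\<^sub>L h - f o\<^sub>C\<^sub>L k"
  by (rule cblinfun_eqI, simp add: cblinfun_compose.rep_eq cblinfun_apply_ops cblinfun_apply_right)+

lemma cblinfun_compose_scaleR:
  "(r *\<^sub>R f) o\<^sub>C\<^sub>L h = r *\<^sub>R (f o\<^sub>C\<^sub>L h)" "f o\<^sub>C\<^sub>L (r *\<^sub>R h) = r *\<^sub>R (f o\<^sub>C\<^sub>L h)"
  by (rule cblinfun_eqI, simp add: cblinfun_compose.rep_eq cblinfun_apply_ops cblinfun_apply_right)+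

lemma cblinfun_compose_zero [simp]: "0 o\<^sub>C\<^sub>L f = 0" "f o\<^sub>C\<^sub>L 0 = 0"
  by (rule cblinfun_eqI, simp add: cblinfun_compose.rep_eq cblinfun_apply_ops)+

lemma cadjoint_eqI: "(\<And>x y. cinner (cblinfun_apply T x) y = cinner x (cblinfun_apply S y)) \<Longrightarrow> cadjoint T = S"
  by (intro cblinfun_eqI cinner_eqI) (simp add: cadjoint[symmetric])

lemma cadjoint_id [simp]: "cadjoint id_op = id_op"
  by (rule cadjoint_eqI) (simp add: id_op.rep_eq)

lemma cadjoint_cadjoint [simp]: "cadjoint (cadjoint T) = T"
proof (rule cadjoint_eqI)
  fix x y
  show "cinner (cadjoint T x) y = cinner x (T y)"
    by (subst (1 2) cinner_commute) (simp add: cadjoint)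
qed

lemma cadjoint_compose: "cadjoint (S o\<^sub>C\<^sub>L T) = cadjoint T o\<^sub>C\<^sub>L cadjoint S"
  by (rule cadjoint_eqI) (simp add: cblinfun_compose.rep_eq cadjoint)

lemma norm_cadjoint_compose: "norm (cadjoint T o\<^sub>C\<^sub>L T) \<le> (norm T)\<^sup>2"
proof -
  have "norm (cadjoint T o\<^sub>C\<^sub>L T) \<le> norm (cadjoint T) * norm T"
    by (rule norm_cblinfun_compose)
  also have "\<dots> \<le> norm T * norm T"
    by (intro mult_right_mono norm_cadjoint) simp
  finally show ?thesis
    by (simp add: power2_eq_square)
qed

lemma bidual_embed_ops:
  "bidual_embed (S + T) = bidual_embed S + bidual_embed T"
  "bidual_embed (S - T) = bidual_embed S - bidual_embed T"
  "bidual_embed (r *\<^sub>R S) = r *\<^sub>R bidual_embed S"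
  "bidual_embed (c *\<^sub>C S) = c *\<^sub>C bidual_embed S"
  "bidual_embed 0 = 0"
  by (rule cblinfun_eqI, simp add: bidual_embed.rep_eq cblinfun_apply_ops cblinfun_apply_right)+

lemma norm_bidual_embed: "norm (bidual_embed T) \<le> norm T"
proof (rule norm_cblinfun_bound)
  show "norm (bidual_embed T \<phi>) \<le> norm T * norm \<phi>" for \<phi>
    using norm_cblinfun[of \<phi> T] by (simp add: bidual_embed.rep_eq mult.commute)
qed simp

lemma norm_arens: "norm (\<eta> \<cdot>\<^sub>A \<nu>) \<le> norm \<eta> * norm \<nu>"
proof (rule norm_cblinfun_bound)
  fix \<phi>
  have "norm (\<eta> (arens_bidual_dual \<nu> \<phi>)) \<le> norm \<eta> * (norm \<nu> * norm \<phi>)"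
    by (rule order_trans[OF norm_cblinfun]) (simp add: norm_arens_bidual_dual mult_left_mono)
  then show "norm ((\<eta> \<cdot>\<^sub>A \<nu>) \<phi>) \<le> norm \<eta> * norm \<nu> * norm \<phi>"
    by (simp add: arens.rep_eq mult.assoc)
qed simp

lemma arens_bidual_dual_ops:
  "arens_bidual_dual (\<eta> + \<nu>) \<phi> = arens_bidual_dual \<eta> \<phi> + arens_bidual_dual \<nu> \<phi>"
  "arens_bidual_dual (\<eta> - \<nu>) \<phi> = arens_bidual_dual \<eta> \<phi> - arens_bidual_dual \<nu> \<phi>"
  "arens_bidual_dual (r *\<^sub>R \<eta>) \<phi> = r *\<^sub>R arens_bidual_dual \<eta> \<phi>"
  "arens_bidual_dual (c *\<^sub>C \<eta>) \<phi> = c *\<^sub>C arens_bidual_dual \<eta> \<phi>"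
  by (rule cblinfun_eqI, simp add: arens_bidual_dual.rep_eq cblinfun_apply_ops)+

lemma arens_linear:
  "(\<eta> + \<nu>) \<cdot>\<^sub>A \<mu> = \<eta> \<cdot>\<^sub>A \<mu> + \<nu> \<cdot>\<^sub>A \<mu>"
  "(\<eta> - \<nu>) \<cdot>\<^sub>A \<mu> = \<eta> \<cdot>\<^sub>A \<mu> - \<nu> \<cdot>\<^sub>A \<mu>"
  "(r *\<^sub>R \<eta>) \<cdot>\<^sub>A \<mu> = r *\<^sub>R (\<eta> \<cdot>\<^sub>A \<mu>)"
  "(c *\<^sub>C \<eta>) \<cdot>\<^sub>A \<mu> = c *\<^sub>C (\<eta> \<cdot>\<^sub>A \<mu>)"
  "\<mu> \<cdot>\<^sub>A (\<eta> + \<nu>) = \<mu> \<cdot>\<^sub>A \<eta> + \<mu> \<cdot>\<^sub>A \<nu>"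
  "\<mu> \<cdot>\<^sub>A (\<eta> - \<nu>) = \<mu> \<cdot>\<^sub>A \<eta> - \<mu> \<cdot>\<^sub>A \<nu>"
  "\<mu> \<cdot>\<^sub>A (r *\<^sub>R \<eta>) = r *\<^sub>R (\<mu> \<cdot>\<^sub>A \<eta>)"
  "\<mu> \<cdot>\<^sub>A (c *\<^sub>C \<eta>) = c *\<^sub>C (\<mu> \<cdot>\<^sub>A \<eta>)"
  by (rule cblinfun_eqI, simp add: arens.rep_eq cblinfun_apply_ops cblinfun_apply_right
      arens_bidual_dual_ops)+

lemma arens_assoc: "(\<eta> \<cdot>\<^sub>A \<nu>) \<cdot>\<^sub>A \<mu> = \<eta> \<cdot>\<^sub>A (\<nu> \<cdot>\<^sub>A \<mu>)"
proof (rule cblinfun_eqI)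
  fix \<phi>
  have op: "arens_dual_op (arens_bidual_dual \<mu> \<phi>) S = arens_bidual_dual \<mu> (arens_dual_op \<phi> S)" for S
  proof (rule cblinfun_eqI)
    fix T
    have "arens_dual_op \<phi> (S o\<^sub>C\<^sub>L T) = arens_dual_op (arens_dual_op \<phi> S) T"
      by (rule cblinfun_eqI) (simp add: arens_dual_op.rep_eq cblinfun_compose_assoc)
    then show "arens_dual_op (arens_bidual_dual \<mu> \<phi>) S T = arens_bidual_dual \<mu> (arens_dual_op \<phi> S) T"
      by (simp add: arens_dual_op.rep_eq arens_bidual_dual.rep_eq)
  qed
  have "arens_bidual_dual \<nu> (arens_bidual_dual \<mu> \<phi>) = arens_bidual_dual (\<nu> \<cdot>\<^sub>A \<mu>) \<phi>"
    by (rule cblinfun_eqI) (simp add: arens_bidual_dual.rep_eq arens.rep_eq op)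
  then show "((\<eta> \<cdot>\<^sub>A \<nu>) \<cdot>\<^sub>A \<mu>) \<phi> = (\<eta> \<cdot>\<^sub>A (\<nu> \<cdot>\<^sub>A \<mu>)) \<phi>"
    by (simp add: arens.rep_eq)
qed

abbreviation bidual_one :: "('h::complex_hilbert_space) bop bidual"
  where "bidual_one \<equiv> bidual_embed id_op"

lemma arens_dual_op_id [simp]: "arens_dual_op \<phi> id_op = \<phi>"
  by (rule cblinfun_eqI) (simp add: arens_dual_op.rep_eq)

lemma arens_embed_left: "(bidual_embed S \<cdot>\<^sub>A \<eta>) \<phi> = \<eta> (arens_dual_op \<phi> S)"
  by (simp add: arens.rep_eq bidual_embed.rep_eq arens_bidual_dual.rep_eq)

lemma arens_one [simp]: "bidual_one \<cdot>\<^sub>A \<eta> = \<eta>" "\<eta> \<cdot>\<^sub>A bidual_one = \<eta>"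
proof -
  show "bidual_one \<cdot>\<^sub>A \<eta> = \<eta>"
    by (rule cblinfun_eqI) (simp add: arens_embed_left)
  have "arens_bidual_dual bidual_one \<phi> = \<phi>" for \<phi> :: "'a bop dual"
    by (rule cblinfun_eqI) (simp add: arens_bidual_dual.rep_eq bidual_embed.rep_eq arens_dual_op.rep_eq)
  then show "\<eta> \<cdot>\<^sub>A bidual_one = \<eta>"
    by (intro cblinfun_eqI) (simp add: arens.rep_eq)
qed

lemma dual_star_dual_star [simp]: "dual_star (dual_star \<phi>) = \<phi>"
  by (rule cblinfun_eqI) (simp add: dual_star.rep_eq)

lemma bidual_star_star [simp]: "bidual_star (bidual_star \<eta>) = \<eta>"
  by (rule cblinfun_eqI) (simp add: bidual_star.rep_eq)

lemma bidual_star_ops: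
  "bidual_star (\<eta> + \<nu>) = bidual_star \<eta> + bidual_star \<nu>"
  "bidual_star (\<eta> - \<nu>) = bidual_star \<eta> - bidual_star \<nu>"
  "bidual_star (r *\<^sub>R \<eta>) = r *\<^sub>R bidual_star \<eta>"
  "bidual_star (c *\<^sub>C \<eta>) = cnj c *\<^sub>C bidual_star \<eta>"
  by (rule cblinfun_eqI, simp add: bidual_star.rep_eq cblinfun_apply_ops scaleC_complex_def)+

lemma bidual_star_one [simp]: "bidual_star bidual_one = bidual_one"
  by (simp add: bidual_star_embed)

lemma norm_dual_star: "norm (dual_star \<phi>) \<le> norm \<phi>"
proof (rule norm_cblinfun_bound)
  fix T
  have "norm (\<phi> (cadjoint T)) \<le> norm \<phi> * norm T"
    by (rule order_trans[OF norm_cblinfun]) (simp add: norm_cadjoint mult_left_mono)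
  then show "norm (dual_star \<phi> T) \<le> norm \<phi> * norm T"
    by (simp add: dual_star.rep_eq)
qed simp

lemma norm_bidual_star: "norm (bidual_star \<eta>) \<le> norm \<eta>"
proof (rule norm_cblinfun_bound)
  fix \<phi>
  have "norm (\<eta> (dual_star \<phi>)) \<le> norm \<eta> * norm \<phi>"
    by (rule order_trans[OF norm_cblinfun]) (simp add: norm_dual_star mult_left_mono)
  then show "norm (bidual_star \<eta> \<phi>) \<le> norm \<eta> * norm \<phi>"
    by (simp add: bidual_star.rep_eq)
qed simp

section \<open>Simultaneous norm approximation of points of the bipolar\<close>

text \<open>If no \<open>r\<close> does it, then all points \<open>(u - r, v - br)\<close> lie outside a ball for a weighted maximum
  norm on pairs of operators. A functional that is constantly \<open>1\<close> on this affine set splits into \<open>\<phi>\<close> and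
  \<open>\<psi>\<close>; it vanishes on the pairs \<open>(r, br)\<close>, so \<open>\<eta>\<close> annihilates \<open>\<phi> + \<psi>(b \<cdot>)\<close>. Hence the value \<open>1\<close> can be
  computed from \<open>u - \<eta>\<close> and \<open>v - b\<eta>\<close>, whose norms are too small for that. Two simultaneous
  conditions are needed because the corrections must be small and also lower a norm.\<close>

lemma bipolar_approximation:
  fixes R :: "('h::complex_hilbert_space) bop set" and \<eta> :: "'h bop bidual"
  assumes R0: "0 \<in> R" and Radd: "\<And>x y. x \<in> R \<Longrightarrow> y \<in> R \<Longrightarrow> x + y \<in> R"
    and Rscale: "\<And>c x. x \<in> R \<Longrightarrow> c *\<^sub>C x \<in> R"
    and \<eta>: "\<eta> \<in> alg_bidual R" and \<tau>: "0 < \<tau>"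
  obtains r where "r \<in> R" "norm (u - r) \<le> norm (bidual_embed u - \<eta>) + \<tau>"
    "norm (v - (b o\<^sub>C\<^sub>L r)) \<le> norm (bidual_embed v - bidual_embed b \<cdot>\<^sub>A \<eta>) + \<tau>"
proof (rule ccontr)
  define \<alpha> where "\<alpha> = norm (bidual_embed u - \<eta>) + \<tau>"
  define \<beta> where "\<beta> = norm (bidual_embed v - bidual_embed b \<cdot>\<^sub>A \<eta>) + \<tau>"
  have pos: "\<alpha> > 0" "\<beta> > 0"
    using \<tau> by (simp_all add: \<alpha>_def \<beta>_def add_nonneg_pos)
  define N where "N = (\<lambda>(x::'h bop, y::'h bop). max (norm x / \<alpha>) (norm y / \<beta>))"
  \<comment> \<open>The graph of the functional that has value \<open>t\<close> at \<open>t(u, v) - (r, br)\<close>.\<close>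
  define G0 where "G0 = {((t *\<^sub>R u - r, t *\<^sub>R v - (b o\<^sub>C\<^sub>L r)), t) |t r. r \<in> R}"
  assume "\<not> thesis"
  then have "\<forall>r\<in>R. \<alpha> < norm (u - r) \<or> \<beta> < norm (v - (b o\<^sub>C\<^sub>L r))"
    using that unfolding \<alpha>_def \<beta>_def by (meson not_le)
  then have far: "1 \<le> N (u - r, v - (b o\<^sub>C\<^sub>L r))" if "r \<in> R" for r
    using that pos by (fastforce simp: N_def le_max_iff_disj)
  have Rscale': "t *\<^sub>R x \<in> R" if "x \<in> R" for t x
    using Rscale[OF that, of "complex_of_real t"] by (simp add: scaleC_of_real)
  have N_add: "N (z + z') \<le> N z + N z'" for z z'
  proof -
    obtain x y x' y' where z: "z = (x, y)" "z' = (x', y')"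
      by (cases z, cases z')
    have "norm (x + x') / \<alpha> \<le> norm x / \<alpha> + norm x' / \<alpha>"
      "norm (y + y') / \<beta> \<le> norm y / \<beta> + norm y' / \<beta>"
      using pos by (simp_all add: add_divide_distrib[symmetric] divide_right_mono norm_triangle_ineq)
    then show ?thesis
      unfolding z N_def by simp linarith
  qed
  have N_scale: "N (t *\<^sub>R z) = t * N z" if "0 < t" for t z
    using that by (cases z) (simp add: N_def max_mult_distrib_left)
  have "subspace G0"
  proof (rule subspaceI)
    have "((0 *\<^sub>R u - 0, 0 *\<^sub>R v - (b o\<^sub>C\<^sub>L 0)), 0) \<in> G0"
      unfolding G0_def using R0 by blast
    then show "0 \<in> G0"
      by (simp add: zero_prod_def)
    fix z assume "z \<in> G0"
    then obtain t r where z: "z = ((t *\<^sub>R u - r, t *\<^sub>R v - (b o\<^sub>C\<^sub>L r)), t)" "r \<in> R"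
      by (auto simp: G0_def)
    show "c *\<^sub>R z \<in> G0" for c
      unfolding G0_def mem_Collect_eq using Rscale'[OF z(2), of c]
      by (intro exI[of _ "c * t"] exI[of _ "c *\<^sub>R r"])
        (simp add: z(1) scaleR_diff_right cblinfun_compose_scaleR)
    fix z' assume "z' \<in> G0"
    then obtain t' r' where z': "z' = ((t' *\<^sub>R u - r', t' *\<^sub>R v - (b o\<^sub>C\<^sub>L r')), t')" "r' \<in> R"
      by (auto simp: G0_def)
    show "z + z' \<in> G0"
      unfolding G0_def mem_Collect_eq using Radd[OF z(2) z'(2)]
      by (intro exI[of _ "t + t'"] exI[of _ "r + r'"])
        (simp add: z(1) z'(1) scaleR_add_left cblinfun_compose_linear algebra_simps)
  qed
  moreover have "t \<le> N z" if zt: "(z, t) \<in> G0" for z t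
  proof -
    obtain r where z: "z = (t *\<^sub>R u - r, t *\<^sub>R v - (b o\<^sub>C\<^sub>L r))" and r: "r \<in> R"
      using zt by (auto simp: G0_def)
    show ?thesis
    proof (cases "0 < t")
      case True
      let ?r = "(1 / t) *\<^sub>R r"
      have "t *\<^sub>R (u - ?r, v - (b o\<^sub>C\<^sub>L ?r)) = z"
        using True by (simp add: z scaleR_diff_right cblinfun_compose_scaleR)
      then show ?thesis
        using far[OF Rscale'[OF r]] N_scale[OF True] True by (metis mult.right_neutral mult_le_cancel_left_pos)
    next
      case False
      moreover have "0 \<le> N z"
        using pos by (simp add: N_def z le_max_iff_disj)
      ultimately show ?thesis by linarith
    qed
  qed
  ultimately obtain g where g: "linear g" "\<And>z t. (z, t) \<in> G0 \<Longrightarrow> g z = t" "\<And>z. g z \<le> N z"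
    using hahn_banach[OF N_add N_scale] by blast
  have g_split: "g (x, y) = g (x, 0) + g (0, y)" for x y
    using linear_add[OF g(1), of "(x, 0)" "(0, y)"] by simp
  have lin: "linear (\<lambda>x. g (x, 0))" "linear (\<lambda>y. g (0, y))"
    using linear_add[OF g(1), of "(x, 0)" "(y, 0)" for x y]
      linear_scale[OF g(1), of c "(x, 0)" for c x]
      linear_add[OF g(1), of "(0, x)" "(0, y)" for x y]
      linear_scale[OF g(1), of c "(0, x)" for c x]
    by (auto intro!: linearI)
  have bound: "g (x, 0) \<le> 1 / \<alpha> * norm x" "g (0, y) \<le> 1 / \<beta> * norm y" for x y
    using g(3)[of "(x, 0)"] g(3)[of "(0, y)"] pos by (simp_all add: N_def)
  obtain \<phi> where \<phi>: "\<And>x. cblinfun_apply \<phi> x = Complex (g (x, 0)) (- g (\<i> *\<^sub>C x, 0))"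
    using complexify_functional[OF lin(1) bound(1)] by blast
  obtain \<psi> where \<psi>: "\<And>y. cblinfun_apply \<psi> y = Complex (g (0, y)) (- g (0, \<i> *\<^sub>C y))"
    using complexify_functional[OF lin(2) bound(2)] by blast
  have le1: "g (x, 0) + g (0, y) \<le> 1" if "norm x \<le> \<alpha>" "norm y \<le> \<beta>" for x y
  proof -
    have "N (x, y) \<le> 1"
      using that pos by (simp add: N_def)
    then show ?thesis
      using g(3)[of "(x, y)"] g_split[of x y] by linarith
  qed
  have "\<alpha> * norm \<phi> \<le> 1 - g (0, y)" if "norm y \<le> \<beta>" for y
    by (rule norm_functional_le) (use pos le1[OF _ that] in \<open>auto simp: \<phi> algebra_simps\<close>)
  then have "g (0, y) \<le> 1 - \<alpha> * norm \<phi>" if "norm y \<le> \<beta>" for y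
    using that by fastforce
  then have "\<beta> * norm \<psi> \<le> 1 - \<alpha> * norm \<phi>"
    by (intro norm_functional_le) (use pos in \<open>auto simp: \<psi>\<close>)
  then have sum: "\<alpha> * norm \<phi> + \<beta> * norm \<psi> \<le> 1"
    by simp
  \<comment> \<open>The combined functional vanishes on \<open>R\<close>, hence \<open>\<eta>\<close> vanishes at it.\<close>
  define \<omega> where "\<omega> = \<phi> + arens_dual_op \<psi> b"
  have \<omega>: "\<omega> r = 0" if "r \<in> R" for r
  proof -
    have vanish: "g (r, 0) + g (0, b o\<^sub>C\<^sub>L r) = 0" if "r \<in> R" for r
    proof -
      have "((0 *\<^sub>R u - r, 0 *\<^sub>R v - (b o\<^sub>C\<^sub>L r)), 0) \<in> G0"
        unfolding G0_def using that by blast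
      from g(2)[OF this] have "g (- (r, b o\<^sub>C\<^sub>L r)) = 0"
        by simp
      then show ?thesis
        using linear_neg[OF g(1), of "(r, b o\<^sub>C\<^sub>L r)"] g_split[of r "b o\<^sub>C\<^sub>L r"] by linarith
    qed
    show ?thesis
      using vanish[OF that] vanish[OF Rscale[OF that, of \<i>]]
      by (simp add: \<omega>_def complex_eq_iff cblinfun_apply_ops arens_dual_op.rep_eq \<phi> \<psi>
          cblinfun_compose_linear)
  qed
  then have "\<eta> \<omega> = 0"
    using \<eta> by (simp add: alg_bidual_def)
  then have "\<eta> \<phi> + (bidual_embed b \<cdot>\<^sub>A \<eta>) \<psi> = 0"
    by (simp add: \<omega>_def cblinfun_apply_right arens_embed_left)
  moreover have "((1 *\<^sub>R u - 0, 1 *\<^sub>R v - (b o\<^sub>C\<^sub>L 0)), 1) \<in> G0"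
    unfolding G0_def using R0 by blast
  from g(2)[OF this] have "g (u, v) = 1"
    by simp
  then have "Re (\<phi> u + \<psi> v) = 1"
    by (simp add: \<phi> \<psi> g_split[of u v])
  ultimately have "1 = Re ((bidual_embed u - \<eta>) \<phi> + (bidual_embed v - bidual_embed b \<cdot>\<^sub>A \<eta>) \<psi>)"
    by (simp add: cblinfun_apply_ops bidual_embed.rep_eq complex_eq_iff)
  also have "\<dots> \<le> cmod ((bidual_embed u - \<eta>) \<phi>) + cmod ((bidual_embed v - bidual_embed b \<cdot>\<^sub>A \<eta>) \<psi>)"
    by (meson complex_Re_le_cmod norm_triangle_ineq order_trans)
  also have "\<dots> \<le> (\<alpha> - \<tau>) * norm \<phi> + (\<beta> - \<tau>) * norm \<psi>"
    unfolding \<alpha>_def \<beta>_def add_diff_cancel_right' by (intro add_mono norm_cblinfun)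
  finally have "\<tau> * (norm \<phi> + norm \<psi>) \<le> 0"
    and ge: "1 \<le> (\<alpha> - \<tau>) * norm \<phi> + (\<beta> - \<tau>) * norm \<psi>"
    using sum by (simp_all add: algebra_simps)
  then have "norm \<phi> + norm \<psi> \<le> 0"
    using \<tau> by (simp add: mult_le_0_iff)
  then have "norm \<phi> = 0" "norm \<psi> = 0"
    using norm_ge_zero[of \<phi>] norm_ge_zero[of \<psi>] by linarith+
  then show False
    using ge by simp
qed

section \<open>Semi-inner products\<close>

lemma quadratic_nonneg_imp:
  fixes a b c :: real
  assumes quad: "\<And>t. 0 \<le> a + 2 * t * b + t\<^sup>2 * c" and c: "0 \<le> c"
  shows "b\<^sup>2 \<le> a * c"
proof (cases "c = 0")
  case True
  have "b = 0"
  proof (rule ccontr)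
    assume "b \<noteq> 0"
    then have "a + 2 * (- (a + 1) / (2 * b)) * b = - 1"
      by (simp add: field_simps)
    then show False
      using quad[of "- (a + 1) / (2 * b)"] True by simp
  qed
  then show ?thesis
    using True by simp
next
  case False
  then have "a + 2 * (- b / c) * b + (- b / c)\<^sup>2 * c = a - b\<^sup>2 / c"
    by (simp add: field_simps power2_eq_square)
  then have "b\<^sup>2 / c \<le> a"
    using quad[of "- b / c"] by simp
  then show ?thesis
    using False c by (simp add: divide_le_eq)
qed

lemma nonpos_if_le_small_multiples:
  fixes D K :: real
  assumes "\<And>\<epsilon>. 0 < \<epsilon> \<Longrightarrow> \<epsilon> \<le> 1 \<Longrightarrow> D \<le> \<epsilon> * K"
  shows "D \<le> 0"
proof (rule ccontr)
  assume D: "\<not> D \<le> 0"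
  then have K: "0 < K"
    using assms[of 1] by simp
  have "D \<le> min 1 (D / (2 * K)) * K"
    using D K by (intro assms) auto
  also have "\<dots> \<le> D / (2 * K) * K"
    using K by (intro mult_right_mono) auto
  finally show False
    using D K by simp
qed

locale semi_inner =
  fixes F :: "'a::complex_normed_vector \<Rightarrow> 'a \<Rightarrow> complex"
  assumes add_right: "F x (y + z) = F x y + F x z"
    and scale_right: "F x (c *\<^sub>C y) = c * F x y"
    and herm: "F x y = cnj (F y x)"
    and pos: "0 \<le> Re (F x x)"
begin

lemma add_left: "F (x + y) z = F x z + F y z"
  by (subst (1 2 3) herm) (simp add: add_right)

lemma scale_left: "F (c *\<^sub>C x) y = cnj c * F x y"
  by (subst (1 2) herm) (simp add: scale_right)

lemma Re_scaled_square: "Re (F (c *\<^sub>C x) (c *\<^sub>C x)) = (cmod c)\<^sup>2 * Re (F x x)"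
proof -
  have "F (c *\<^sub>C x) (c *\<^sub>C x) = complex_of_real ((cmod c)\<^sup>2) * F x x"
    unfolding complex_norm_square by (simp add: scale_left scale_right)
  then show ?thesis
    by (simp del: of_real_power)
qed

lemma Re_square_line:
  "Re (F (x + t *\<^sub>R y) (x + t *\<^sub>R y)) = Re (F x x) + 2 * t * Re (F x y) + t\<^sup>2 * Re (F y y)"
proof -
  have "Re (F y x) = Re (F x y)"
    by (subst herm) simp
  then show ?thesis
    by (simp add: scaleC_of_real[symmetric] add_left add_right scale_left scale_right
        power2_eq_square algebra_simps)
qed

lemma cauchy_schwarz: "(cmod (F x y))\<^sup>2 \<le> Re (F x x) * Re (F y y)"
proof -
  have real: "(Re (F x y))\<^sup>2 \<le> Re (F x x) * Re (F y y)" for x y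
    by (rule quadratic_nonneg_imp) (simp_all add: pos flip: Re_square_line)
  define c where "c = (if F x y = 0 then 1 else cnj (F x y) / cmod (F x y))"
  have c: "cmod c = 1" and "c * F x y = cmod (F x y)"
    by (simp_all add: c_def norm_divide complex_norm_square[symmetric] power2_eq_square mult.commute)
  then have "Re (F x (c *\<^sub>C y)) = cmod (F x y)"
    by (simp only: scale_right Re_complex_of_real)
  then show ?thesis
    using real[of x "c *\<^sub>C y"] by (simp only: Re_scaled_square c) simp
qed

lemma cauchy_schwarz_sqrt: "cmod (F x y) \<le> sqrt (Re (F x x)) * sqrt (Re (F y y))"
  using real_le_rsqrt[OF cauchy_schwarz] by (simp add: real_sqrt_mult)

text \<open>Without completeness the Riesz representation still holds up to \<open>\<epsilon>\<close>: take \<open>z\<close> that minimises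
  \<open>F x x - 2 Re (g x)\<close> up to \<open>\<epsilon>\<^sup>2\<close>; along any line through \<open>z\<close> this quadratic function stays above its
  value at \<open>z\<close> minus \<open>\<epsilon>\<^sup>2\<close>, which bounds its linear coefficient.\<close>

lemma approx_riesz:
  assumes add: "\<And>x y. g (x + y) = g x + g y" and scale: "\<And>c x. g (c *\<^sub>C x) = c * g x"
    and bound: "\<And>x. cmod (g x) \<le> C * sqrt (Re (F x x))" and \<epsilon>: "0 < \<epsilon>"
  obtains z where "\<And>x. cmod (g x - F z x) \<le> \<epsilon> * sqrt (Re (F x x))"
proof -
  define h where "h x = Re (F x x) - 2 * Re (g x)" for x
  have lower: "- C\<^sup>2 \<le> h x" for x
  proof -
    have "Re (g x) \<le> C * sqrt (Re (F x x))"
      using complex_Re_le_cmod bound by (rule order_trans)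
    moreover have "0 \<le> (sqrt (Re (F x x)) - C)\<^sup>2"
      by simp
    ultimately show ?thesis
      using pos[of x] by (simp add: h_def power2_diff algebra_simps)
  qed
  then have bdd: "bdd_below (range h)"
    by (auto intro!: bdd_belowI2)
  obtain z where z: "h z < (INF x. h x) + \<epsilon>\<^sup>2"
    using cINF_less_iff[OF _ bdd, of "(INF x. h x) + \<epsilon>\<^sup>2"] \<epsilon> by auto
  have min: "h z - \<epsilon>\<^sup>2 \<le> h x" for x
    using z cINF_lower[OF bdd, of x] by simp
  have real: "(Re (F z x - g x))\<^sup>2 \<le> \<epsilon>\<^sup>2 * Re (F x x)" for x
  proof (rule quadratic_nonneg_imp)
    fix t
    have "g (z + t *\<^sub>R x) = g z + t * g x"
      by (simp add: add scaleC_of_real[symmetric] scale)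
    then have "h (z + t *\<^sub>R x) = h z + 2 * t * Re (F z x - g x) + t\<^sup>2 * Re (F x x)"
      by (simp add: h_def Re_square_line algebra_simps)
    then show "0 \<le> \<epsilon>\<^sup>2 + 2 * t * Re (F z x - g x) + t\<^sup>2 * Re (F x x)"
      using min[of "z + t *\<^sub>R x"] by simp
  qed (rule pos)
  have "cmod (g x - F z x) \<le> \<epsilon> * sqrt (Re (F x x))" for x
  proof -
    define d where "d = F z x - g x"
    define c where "c = (if d = 0 then 1 else cnj d / cmod d)"
    have "cmod c = 1" and cd: "c * d = cmod d"
      by (simp_all add: c_def norm_divide complex_norm_square[symmetric] power2_eq_square mult.commute)
    moreover have "F z (c *\<^sub>C x) - g (c *\<^sub>C x) = c * d"
      by (simp add: d_def scale scale_right algebra_simps)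
    ultimately have "(cmod d)\<^sup>2 \<le> \<epsilon>\<^sup>2 * Re (F x x)"
      using real[of "c *\<^sub>C x"] by (simp add: Re_scaled_square)
    then have "cmod d \<le> sqrt (\<epsilon>\<^sup>2 * Re (F x x))"
      by (rule real_le_rsqrt)
    then show ?thesis
      using \<epsilon> by (simp add: real_sqrt_mult d_def norm_minus_commute)
  qed
  then show ?thesis
    by (rule that)
qed

end

section \<open>Positive functionals on operators\<close>

definition positive_functional :: "('h::complex_hilbert_space) bop dual \<Rightarrow> bool"
  where "positive_functional \<psi> \<longleftrightarrow>
    dual_star \<psi> = \<psi> \<and> (\<forall>T. 0 \<le> Re (cblinfun_apply \<psi> (cadjoint T o\<^sub>C\<^sub>L T)))"

text \<open>The norm of the image of \<open>T\<close> in the GNS space of \<open>\<psi>\<close>.\<close>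

definition gns_norm :: "('h::complex_hilbert_space) bop dual \<Rightarrow> 'h bop \<Rightarrow> real"
  where "gns_norm \<psi> T = sqrt (Re (cblinfun_apply \<psi> (cadjoint T o\<^sub>C\<^sub>L T)))"

lemma positive_functional_adjoint:
  "positive_functional \<psi> \<Longrightarrow> \<psi> (cadjoint T) = cnj (\<psi> T)"
  by (metis positive_functional_def dual_star.rep_eq complex_cnj_cnj)

lemma semi_inner_functional:
  assumes "positive_functional \<psi>"
  shows "semi_inner (\<lambda>S T. cblinfun_apply \<psi> (cadjoint S o\<^sub>C\<^sub>L T))"
proof
  fix x y z :: "'a bop" and c
  show "\<psi> (cadjoint x o\<^sub>C\<^sub>L y) = cnj (\<psi> (cadjoint y o\<^sub>C\<^sub>L x))"
    using positive_functional_adjoint[OF assms, of "cadjoint y o\<^sub>C\<^sub>L x"]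
    by (simp add: cadjoint_compose)
  show "0 \<le> Re (\<psi> (cadjoint x o\<^sub>C\<^sub>L x))"
    using assms by (simp add: positive_functional_def)
qed (simp_all add: cblinfun_compose_linear cblinfun_apply_right scaleC_complex_def)

lemma gns_norm_nonneg: "positive_functional \<psi> \<Longrightarrow> 0 \<le> gns_norm \<psi> T"
  by (simp add: positive_functional_def gns_norm_def)

lemma gns_cauchy_schwarz:
  "positive_functional \<psi> \<Longrightarrow> cmod (\<psi> (cadjoint S o\<^sub>C\<^sub>L T)) \<le> gns_norm \<psi> S * gns_norm \<psi> T"
  unfolding gns_norm_def by (rule semi_inner.cauchy_schwarz_sqrt[OF semi_inner_functional])

lemma gns_norm_le:
  assumes "positive_functional \<psi>"
  shows "gns_norm \<psi> T \<le> sqrt (norm \<psi>) * norm T"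
proof -
  have "Re (\<psi> (cadjoint T o\<^sub>C\<^sub>L T)) \<le> norm \<psi> * norm (cadjoint T o\<^sub>C\<^sub>L T)"
    using complex_Re_le_cmod norm_cblinfun by (rule order_trans)
  also have "\<dots> \<le> norm \<psi> * (norm T)\<^sup>2"
    by (intro mult_left_mono norm_cadjoint_compose) simp
  finally have "gns_norm \<psi> T \<le> sqrt (norm \<psi> * (norm T)\<^sup>2)"
    by (simp add: gns_norm_def)
  then show ?thesis
    by (simp add: real_sqrt_mult)
qed

lemma gns_norm_cadjoint_le:
  assumes "positive_functional \<psi>"
  shows "gns_norm \<psi> (cadjoint T) \<le> sqrt (norm \<psi>) * norm T"
  using gns_norm_le[OF assms, of "cadjoint T"] norm_cadjoint[of T]
  by (meson mult_left_mono norm_ge_zero order_trans real_sqrt_ge_zero)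

lemma norm_arens_embed_functional:
  assumes \<psi>: "positive_functional \<psi>"
  shows "norm (arens_bidual_dual (bidual_embed S) \<psi>) \<le> sqrt (norm \<psi>) * gns_norm \<psi> S"
proof (rule norm_cblinfun_bound)
  show "0 \<le> sqrt (norm \<psi>) * gns_norm \<psi> S"
    using gns_norm_nonneg[OF \<psi>] by simp
  fix X
  have "cmod (\<psi> (cadjoint (cadjoint X) o\<^sub>C\<^sub>L S)) \<le> gns_norm \<psi> (cadjoint X) * gns_norm \<psi> S"
    by (rule gns_cauchy_schwarz[OF \<psi>])
  also have "\<dots> \<le> (sqrt (norm \<psi>) * norm X) * gns_norm \<psi> S"
    by (intro mult_right_mono gns_norm_cadjoint_le gns_norm_nonneg \<psi>)
  finally show "norm (arens_bidual_dual (bidual_embed S) \<psi> X)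
      \<le> sqrt (norm \<psi>) * gns_norm \<psi> S * norm X"
    by (simp add: arens_bidual_dual.rep_eq bidual_embed.rep_eq arens_dual_op.rep_eq mult_ac)
qed

section \<open>Arens regularity\<close>

text \<open>If \<open>\<xi>\<close> is the cyclic vector of the GNS representation of \<open>\<psi>\<close>, extended to the bidual, this says
  that \<open>Z\<xi>\<close> has distance at most \<open>\<epsilon>\<close> from \<open>\<eta>\<^sup>*\<xi>\<close>. The vector \<open>\<eta>\<^sup>*\<xi>\<close> lives only in the completion and is
  therefore described by its inner products.\<close>

definition gns_approximates ::
    "('h::complex_hilbert_space) bop dual \<Rightarrow> real \<Rightarrow> 'h bop bidual \<Rightarrow> 'h bop \<Rightarrow> bool"
  where "gns_approximates \<psi> \<epsilon> \<eta> Z \<longleftrightarrow>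
    (\<forall>S. cmod (cblinfun_apply (\<eta> \<cdot>\<^sub>A bidual_embed S) \<psi> - cblinfun_apply \<psi> (cadjoint Z o\<^sub>C\<^sub>L S))
      \<le> \<epsilon> * gns_norm \<psi> S)"

lemma cmod_arens_embed_le:
  assumes \<psi>: "positive_functional \<psi>"
  shows "cmod (cblinfun_apply (\<eta> \<cdot>\<^sub>A bidual_embed S) \<psi>) \<le> norm \<eta> * sqrt (norm \<psi>) * gns_norm \<psi> S"
proof -
  have "cmod (\<eta> (arens_bidual_dual (bidual_embed S) \<psi>))
      \<le> norm \<eta> * norm (arens_bidual_dual (bidual_embed S) \<psi>)"
    by (rule norm_cblinfun)
  also have "\<dots> \<le> norm \<eta> * (sqrt (norm \<psi>) * gns_norm \<psi> S)"
    by (intro mult_left_mono norm_arens_embed_functional \<psi>) simp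
  finally show ?thesis
    by (simp add: arens.rep_eq mult.assoc)
qed

lemma gns_approximates_exists:
  assumes \<psi>: "positive_functional \<psi>" and \<epsilon>: "0 < \<epsilon>"
  obtains Z where "gns_approximates \<psi> \<epsilon> \<eta> Z"
proof -
  interpret semi_inner "\<lambda>S T. cblinfun_apply \<psi> (cadjoint S o\<^sub>C\<^sub>L T)"
    by (rule semi_inner_functional[OF \<psi>])
  have "\<exists>Z. \<forall>S. cmod ((\<eta> \<cdot>\<^sub>A bidual_embed S) \<psi> - \<psi> (cadjoint Z o\<^sub>C\<^sub>L S))
      \<le> \<epsilon> * sqrt (Re (\<psi> (cadjoint S o\<^sub>C\<^sub>L S)))"
  proof (rule approx_riesz[OF _ _ _ \<epsilon>])
    show "cmod ((\<eta> \<cdot>\<^sub>A bidual_embed S) \<psi>)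
        \<le> (norm \<eta> * sqrt (norm \<psi>)) * sqrt (Re (\<psi> (cadjoint S o\<^sub>C\<^sub>L S)))" for S
      using cmod_arens_embed_le[OF \<psi>] by (simp add: gns_norm_def)
  qed (auto simp: bidual_embed_ops arens_linear cblinfun_apply_ops scaleC_complex_def)
  then show ?thesis
    using that unfolding gns_approximates_def gns_norm_def by blast
qed

lemma bidual_star_arens_embed:
  "bidual_star (bidual_embed S \<cdot>\<^sub>A \<eta>) = bidual_star \<eta> \<cdot>\<^sub>A bidual_embed (cadjoint S)"
proof (rule cblinfun_eqI)
  fix \<phi>
  have "dual_star (arens_bidual_dual (bidual_embed (cadjoint S)) \<phi>) = arens_dual_op (dual_star \<phi>) S"
    by (rule cblinfun_eqI) (simp add: dual_star.rep_eq arens_bidual_dual.rep_eq bidual_embed.rep_eq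
        arens_dual_op.rep_eq cadjoint_compose)
  then show "bidual_star (bidual_embed S \<cdot>\<^sub>A \<eta>) \<phi> = (bidual_star \<eta> \<cdot>\<^sub>A bidual_embed (cadjoint S)) \<phi>"
    by (simp add: bidual_star.rep_eq arens_embed_left) (simp add: arens.rep_eq bidual_star.rep_eq)
qed

lemma bidual_star_positive:
  "positive_functional \<psi> \<Longrightarrow> bidual_star \<eta> \<psi> = cnj (\<eta> \<psi>)"
  by (simp add: bidual_star.rep_eq positive_functional_def)

text \<open>In the GNS picture \<open>(\<eta>\<nu>)(\<psi>)\<close> is the inner product of \<open>\<eta>\<^sup>*\<xi>\<close> and \<open>\<nu>\<xi>\<close>; replacing both vectors by
  nearby images of operators changes it by a multiple of \<open>\<epsilon>\<close>. By definition
  \<open>(\<eta>\<nu>)(\<psi>)\<close> is \<open>\<eta>\<close> at the functional \<open>\<nu> \<cdot> \<psi>\<close>, so \<open>\<nu>\<close> is replaced first, with an error that is small in the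
  norm of the dual.\<close>

lemma arens_approx:
  assumes \<psi>: "positive_functional \<psi>" and \<epsilon>: "0 < \<epsilon>" "\<epsilon> \<le> 1"
    and Z: "gns_approximates \<psi> \<epsilon> \<eta> Z" and T: "gns_approximates \<psi> \<epsilon> (bidual_star \<nu>) T"
  shows "cmod (cblinfun_apply (\<eta> \<cdot>\<^sub>A \<nu>) \<psi> - cblinfun_apply \<psi> (cadjoint Z o\<^sub>C\<^sub>L T))
    \<le> \<epsilon> * ((norm \<eta> + norm \<nu>) * sqrt (norm \<psi>) + 1)"
proof -
  let ?k = "sqrt (norm \<psi>)"
  have left: "cmod ((bidual_embed S \<cdot>\<^sub>A \<nu>) \<psi> - \<psi> (S o\<^sub>C\<^sub>L T)) \<le> \<epsilon> * gns_norm \<psi> (cadjoint S)" for S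
  proof -
    have "(bidual_star \<nu> \<cdot>\<^sub>A bidual_embed (cadjoint S)) \<psi> - \<psi> (cadjoint T o\<^sub>C\<^sub>L cadjoint S)
        = cnj ((bidual_embed S \<cdot>\<^sub>A \<nu>) \<psi> - \<psi> (S o\<^sub>C\<^sub>L T))"
      by (simp add: bidual_star_arens_embed[symmetric] bidual_star_positive[OF \<psi>]
          cadjoint_compose[symmetric] positive_functional_adjoint[OF \<psi>])
    then show ?thesis
      using T unfolding gns_approximates_def by (metis complex_mod_cnj)
  qed
  have "norm (arens_bidual_dual \<nu> \<psi> - arens_bidual_dual (bidual_embed T) \<psi>) \<le> \<epsilon> * ?k"
  proof (rule norm_cblinfun_bound)
    fix S
    have "cmod ((bidual_embed S \<cdot>\<^sub>A \<nu>) \<psi> - \<psi> (S o\<^sub>C\<^sub>L T)) \<le> \<epsilon> * (?k * norm S)"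
      using left[of S] mult_left_mono[OF gns_norm_cadjoint_le[OF \<psi>, of S], of \<epsilon>] \<epsilon> by linarith
    then show "norm ((arens_bidual_dual \<nu> \<psi> - arens_bidual_dual (bidual_embed T) \<psi>) S)
        \<le> \<epsilon> * ?k * norm S"
      by (simp add: cblinfun_apply_ops arens_bidual_dual.rep_eq bidual_embed.rep_eq
          arens_dual_op.rep_eq arens_embed_left mult.assoc)
  qed (use \<epsilon> in simp)
  then have "norm \<eta> * norm (arens_bidual_dual \<nu> \<psi> - arens_bidual_dual (bidual_embed T) \<psi>)
      \<le> norm \<eta> * (\<epsilon> * ?k)"
    by (rule mult_left_mono) simp
  then have 1: "cmod ((\<eta> \<cdot>\<^sub>A \<nu>) \<psi> - (\<eta> \<cdot>\<^sub>A bidual_embed T) \<psi>) \<le> norm \<eta> * (\<epsilon> * ?k)"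
    using norm_cblinfun[of \<eta> "arens_bidual_dual \<nu> \<psi> - arens_bidual_dual (bidual_embed T) \<psi>"]
    by (simp add: arens.rep_eq cblinfun_apply_right)
  have 2: "cmod ((\<eta> \<cdot>\<^sub>A bidual_embed T) \<psi> - \<psi> (cadjoint Z o\<^sub>C\<^sub>L T)) \<le> \<epsilon> * gns_norm \<psi> T"
    using Z by (simp add: gns_approximates_def)
  have T_bound: "gns_norm \<psi> T \<le> norm \<nu> * ?k + \<epsilon>"
  proof (cases "gns_norm \<psi> T = 0")
    case True
    then show ?thesis
      using \<epsilon> by (simp add: add_nonneg_nonneg)
  next
    case False
    have "gns_norm \<psi> T * gns_norm \<psi> T = Re (\<psi> (cadjoint T o\<^sub>C\<^sub>L T))"
      using \<psi> by (simp add: gns_norm_def positive_functional_def)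
    also have "\<dots> \<le> cmod (\<psi> (cadjoint T o\<^sub>C\<^sub>L T))"
      by (rule complex_Re_le_cmod)
    also have "\<dots> \<le> cmod ((bidual_star \<nu> \<cdot>\<^sub>A bidual_embed T) \<psi>) + \<epsilon> * gns_norm \<psi> T"
      using T norm_triangle_ineq2[of "\<psi> (cadjoint T o\<^sub>C\<^sub>L T)" "(bidual_star \<nu> \<cdot>\<^sub>A bidual_embed T) \<psi>"]
      unfolding gns_approximates_def by (smt (verit, best) norm_minus_commute)
    also have "\<dots> \<le> norm (bidual_star \<nu>) * ?k * gns_norm \<psi> T + \<epsilon> * gns_norm \<psi> T"
      using cmod_arens_embed_le[OF \<psi>] by simp
    also have "\<dots> \<le> norm \<nu> * ?k * gns_norm \<psi> T + \<epsilon> * gns_norm \<psi> T"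
      by (intro add_right_mono mult_right_mono norm_bidual_star gns_norm_nonneg \<psi>) simp
    also have "\<dots> = (norm \<nu> * ?k + \<epsilon>) * gns_norm \<psi> T"
      by (simp add: algebra_simps)
    finally show ?thesis
      using False gns_norm_nonneg[OF \<psi>, of T] by (simp add: mult_le_cancel_right)
  qed
  have "cmod ((\<eta> \<cdot>\<^sub>A \<nu>) \<psi> - \<psi> (cadjoint Z o\<^sub>C\<^sub>L T)) \<le> norm \<eta> * (\<epsilon> * ?k) + \<epsilon> * gns_norm \<psi> T"
    using norm_triangle_ineq[of "(\<eta> \<cdot>\<^sub>A \<nu>) \<psi> - (\<eta> \<cdot>\<^sub>A bidual_embed T) \<psi>"
        "(\<eta> \<cdot>\<^sub>A bidual_embed T) \<psi> - \<psi> (cadjoint Z o\<^sub>C\<^sub>L T)"] 1 2 by simp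
  also have "\<dots> \<le> norm \<eta> * (\<epsilon> * ?k) + \<epsilon> * (norm \<nu> * ?k + 1)"
    using T_bound \<epsilon> by (intro add_left_mono mult_left_mono) auto
  finally show ?thesis
    by (simp add: algebra_simps)
qed

text \<open>Both sides are approximated by \<open>\<psi>(T\<^sup>*Z)\<close> for the same \<open>Z\<close> and \<open>T\<close>.\<close>

lemma bidual_star_arens_positive:
  assumes \<psi>: "positive_functional \<psi>"
  shows "bidual_star (\<eta> \<cdot>\<^sub>A \<nu>) \<psi> = (bidual_star \<nu> \<cdot>\<^sub>A bidual_star \<eta>) \<psi>"
proof -
  define K where "K = ((norm \<eta> + norm \<nu>) * sqrt (norm \<psi>) + 1)
    + ((norm (bidual_star \<nu>) + norm (bidual_star \<eta>)) * sqrt (norm \<psi>) + 1)"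
  have "cmod (bidual_star (\<eta> \<cdot>\<^sub>A \<nu>) \<psi> - (bidual_star \<nu> \<cdot>\<^sub>A bidual_star \<eta>) \<psi>) \<le> \<epsilon> * K"
    if \<epsilon>: "0 < \<epsilon>" "\<epsilon> \<le> 1" for \<epsilon>
  proof -
    obtain Z where Z: "gns_approximates \<psi> \<epsilon> \<eta> Z"
      using gns_approximates_exists[OF \<psi> \<epsilon>(1)] by blast
    obtain T where T: "gns_approximates \<psi> \<epsilon> (bidual_star \<nu>) T"
      using gns_approximates_exists[OF \<psi> \<epsilon>(1)] by blast
    have adj: "cnj (\<psi> (cadjoint Z o\<^sub>C\<^sub>L T)) = \<psi> (cadjoint T o\<^sub>C\<^sub>L Z)"
      by (simp add: positive_functional_adjoint[OF \<psi>, symmetric] cadjoint_compose)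
    have 1: "cmod (bidual_star (\<eta> \<cdot>\<^sub>A \<nu>) \<psi> - \<psi> (cadjoint T o\<^sub>C\<^sub>L Z))
        \<le> \<epsilon> * ((norm \<eta> + norm \<nu>) * sqrt (norm \<psi>) + 1)"
      using arens_approx[OF \<psi> \<epsilon> Z T]
      by (simp add: bidual_star_positive[OF \<psi>] adj[symmetric] flip: complex_cnj_diff)
    have 2: "cmod ((bidual_star \<nu> \<cdot>\<^sub>A bidual_star \<eta>) \<psi> - \<psi> (cadjoint T o\<^sub>C\<^sub>L Z))
        \<le> \<epsilon> * ((norm (bidual_star \<nu>) + norm (bidual_star \<eta>)) * sqrt (norm \<psi>) + 1)"
      using arens_approx[OF \<psi> \<epsilon> T, of "bidual_star \<eta>" Z] Z by simp
    show ?thesis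
      using norm_triangle_ineq4[of "bidual_star (\<eta> \<cdot>\<^sub>A \<nu>) \<psi> - \<psi> (cadjoint T o\<^sub>C\<^sub>L Z)"
          "(bidual_star \<nu> \<cdot>\<^sub>A bidual_star \<eta>) \<psi> - \<psi> (cadjoint T o\<^sub>C\<^sub>L Z)"] 1 2
      by (simp add: K_def distrib_left)
  qed
  then have "cmod (bidual_star (\<eta> \<cdot>\<^sub>A \<nu>) \<psi> - (bidual_star \<nu> \<cdot>\<^sub>A bidual_star \<eta>) \<psi>) \<le> 0"
    by (rule nonpos_if_le_small_multiples)
  then show ?thesis
    by simp
qed

lemma arens_star_square_nonneg:
  assumes \<psi>: "positive_functional \<psi>"
  shows "0 \<le> Re ((bidual_star \<eta> \<cdot>\<^sub>A \<eta>) \<psi>)"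
proof -
  define K where "K = (norm (bidual_star \<eta>) + norm \<eta>) * sqrt (norm \<psi>) + 1"
  have "- Re ((bidual_star \<eta> \<cdot>\<^sub>A \<eta>) \<psi>) \<le> \<epsilon> * K" if \<epsilon>: "0 < \<epsilon>" "\<epsilon> \<le> 1" for \<epsilon>
  proof -
    obtain Z where Z: "gns_approximates \<psi> \<epsilon> (bidual_star \<eta>) Z"
      using gns_approximates_exists[OF \<psi> \<epsilon>(1)] by blast
    have "0 \<le> Re (\<psi> (cadjoint Z o\<^sub>C\<^sub>L Z))"
      using \<psi> by (simp add: positive_functional_def)
    moreover have "cmod ((bidual_star \<eta> \<cdot>\<^sub>A \<eta>) \<psi> - \<psi> (cadjoint Z o\<^sub>C\<^sub>L Z)) \<le> \<epsilon> * K"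
      unfolding K_def by (rule arens_approx[OF \<psi> \<epsilon> Z Z])
    ultimately show ?thesis
      using abs_Re_le_cmod[of "(bidual_star \<eta> \<cdot>\<^sub>A \<eta>) \<psi> - \<psi> (cadjoint Z o\<^sub>C\<^sub>L Z)"] by simp
  qed
  then have "- Re ((bidual_star \<eta> \<cdot>\<^sub>A \<eta>) \<psi>) \<le> 0"
    by (rule nonpos_if_le_small_multiples)
  then show ?thesis
    by simp
qed

text \<open>Positive functionals on operators thus remain positive on the bidual, so the Cauchy-Schwarz
  inequality holds there as well.\<close>

lemma semi_inner_bidual:
  assumes \<psi>: "positive_functional \<psi>"
  shows "semi_inner (\<lambda>\<eta> \<nu>. cblinfun_apply (bidual_star \<eta> \<cdot>\<^sub>A \<nu>) \<psi>)"
proof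
  fix \<eta> \<nu> :: "'a bop bidual"
  show "(bidual_star \<eta> \<cdot>\<^sub>A \<nu>) \<psi> = cnj ((bidual_star \<nu> \<cdot>\<^sub>A \<eta>) \<psi>)"
    using bidual_star_arens_positive[OF \<psi>, of "bidual_star \<nu>" \<eta>] by (simp add: bidual_star_positive[OF \<psi>])
  show "0 \<le> Re ((bidual_star \<eta> \<cdot>\<^sub>A \<eta>) \<psi>)"
    by (rule arens_star_square_nonneg[OF \<psi>])
qed (simp_all add: arens_linear cblinfun_apply_ops scaleC_complex_def)

section \<open>Positive functionals dominate all functionals\<close>

text \<open>On the block matrices with rows \<open>(0, T)\<close> and \<open>(T\<^sup>*, X)\<close> consider the sublinear functional \<open>N\<close>, the
  supremum of the real parts of the values of the quadratic form at pairs \<open>(g, h)\<close> in the unit balls, where the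
  supremum over \<open>g\<close> turns the off-diagonal terms into \<open>2 \<parallel>Th\<parallel>\<close>. The functional \<open>2 Re \<phi>(T)\<close> is dominated by
  \<open>N\<close> on the matrices with \<open>X = 0\<close>. For an extension \<open>2 Re \<phi>(T) + f(X)\<close> the value at \<open>(T, -T\<^sup>*T)\<close> is at most
  \<open>sup (2 \<parallel>Th\<parallel> - \<parallel>Th\<parallel>\<^sup>2) \<le> 1\<close>, and scaling \<open>T\<close> turns \<open>2 Re \<phi>(T) \<le> 1 + f(T\<^sup>*T)\<close> into the claim for the
  complexification \<open>\<psi>\<close> of \<open>f\<close>.\<close>

lemma functional_dominated:
  fixes \<phi> :: "('h::complex_hilbert_space) bop dual"
  assumes \<phi>: "norm \<phi> \<le> 1"
  obtains \<psi> where "positive_functional \<psi>" "norm \<psi> \<le> 1" "\<And>T. cmod (\<phi> T) \<le> gns_norm \<psi> T"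
proof -
  define q where "q = (\<lambda>(T::'h bop, X::'h bop) h. 2 * norm (cblinfun_apply T h) + inner h (cblinfun_apply X (h::'h)))"
  define N where "N z = (SUP h\<in>cball 0 1. q z h)" for z
  have q_le: "q (T, X) h \<le> 2 * norm T + norm X" if "h \<in> cball 0 1" for T X h
  proof -
    have h: "norm h \<le> 1"
      using that by simp
    have "norm (T h) \<le> norm T"
      using norm_cblinfun[of T h] mult_left_le[OF h norm_ge_zero[of T]] by simp
    moreover have "inner h (X h) \<le> norm X"
    proof -
      have "inner h (X h) \<le> norm h * norm (X h)"
        by (rule norm_cauchy_schwarz)
      also have "\<dots> \<le> 1 * (norm X * 1)"
        using h norm_cblinfun[of X h] mult_left_mono[OF h norm_ge_zero[of X]]
        by (intro mult_mono) auto
      finally show ?thesis by simp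
    qed
    ultimately show ?thesis
      by (simp add: q_def)
  qed
  have bdd: "bdd_above (q z ` cball 0 1)" for z
    using q_le by (cases z) (auto intro!: bdd_aboveI2)
  have q_N: "q z h \<le> N z" if "h \<in> cball 0 1" for z h
    unfolding N_def by (rule cSUP_upper[OF that bdd])
  have N_le: "N z \<le> k" if "\<And>h. h \<in> cball 0 1 \<Longrightarrow> q z h \<le> k" for z k
    unfolding N_def by (rule cSUP_least) (use that in auto)
  have N_add: "N (z + z') \<le> N z + N z'" for z z'
  proof (rule N_le)
    fix h :: 'h assume h: "h \<in> cball 0 1"
    have "q (z + z') h \<le> q z h + q z' h"
      using norm_triangle_ineq[of "fst z h" "fst z' h"]
      by (simp add: q_def case_prod_beta cblinfun_apply_ops inner_add_right)
    then show "q (z + z') h \<le> N z + N z'"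
      using q_N[OF h, of z] q_N[OF h, of z'] by linarith
  qed
  have q_scale: "q (t *\<^sub>R z) h = t * q z h" if "0 < t" for t z h
    using that by (simp add: q_def case_prod_beta cblinfun_apply_ops distrib_left)
  have N_scale: "N (t *\<^sub>R z) = t * N z" if t: "0 < t" for t z
  proof (rule antisym)
    show "N (t *\<^sub>R z) \<le> t * N z"
      using t q_N by (intro N_le) (simp add: q_scale)
    have "N z \<le> N (t *\<^sub>R z) / t"
    proof (rule N_le)
      fix h :: 'h assume "h \<in> cball 0 1"
      then show "q z h \<le> N (t *\<^sub>R z) / t"
        using q_N[of h "t *\<^sub>R z"] t by (simp add: q_scale field_simps)
    qed
    then show "t * N z \<le> N (t *\<^sub>R z)"
      using t by (simp add: field_simps)
  qed
  \<comment> \<open>The graph of \<open>2 Re \<phi>(T)\<close> on the pairs with second component zero.\<close>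
  define G0 where "G0 = range (\<lambda>T::'h bop. ((T, 0::'h bop), 2 * Re (\<phi> T)))"
  have "subspace G0"
  proof (rule subspaceI)
    have "((0, 0), 2 * Re (\<phi> 0)) \<in> G0"
      unfolding G0_def by blast
    then show "0 \<in> G0"
      by (simp add: zero_prod_def)
    fix z assume "z \<in> G0"
    then obtain T where z: "z = ((T, 0), 2 * Re (\<phi> T))"
      by (auto simp: G0_def)
    show "c *\<^sub>R z \<in> G0" for c
      unfolding G0_def by (rule range_eqI[of _ _ "c *\<^sub>R T"]) (simp add: z cblinfun_apply_right)
    fix z' assume "z' \<in> G0"
    then obtain T' where z': "z' = ((T', 0), 2 * Re (\<phi> T'))"
      by (auto simp: G0_def)
    show "z + z' \<in> G0"
      unfolding G0_def by (rule range_eqI[of _ _ "T + T'"]) (simp add: z z' cblinfun_apply_right)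
  qed
  moreover have "r \<le> N z" if zr: "(z, r) \<in> G0" for z r
  proof -
    obtain T where z: "z = (T, 0)" and r: "r = 2 * Re (\<phi> T)"
      using zr by (auto simp: G0_def)
    have "norm T \<le> N (T, 0) / 2"
    proof (rule norm_cblinfun_bound)
      have q: "2 * norm (T h) \<le> N (T, 0)" if "norm h \<le> 1" for h
        using q_N[of h "(T, 0)"] that by (simp add: q_def cblinfun_apply_ops)
      show "0 \<le> N (T, 0) / 2"
        using q[of 0] by simp
      fix h
      show "norm (T h) \<le> N (T, 0) / 2 * norm h"
      proof (cases "h = 0")
        case False
        then show ?thesis
          using q[of "(1 / norm h) *\<^sub>R h"] by (simp add: cblinfun_apply_right field_simps)
      qed simp
    qed
    moreover have "Re (\<phi> T) \<le> norm \<phi> * norm T"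
      using complex_Re_le_cmod norm_cblinfun by (rule order_trans)
    then have "Re (\<phi> T) \<le> norm T"
      using mult_right_mono[OF \<phi> norm_ge_zero[of T]] by simp
    ultimately show ?thesis
      by (simp add: z r)
  qed
  ultimately obtain g where g: "linear g" "\<And>z r. (z, r) \<in> G0 \<Longrightarrow> g z = r" "\<And>z. g z \<le> N z"
    using hahn_banach[OF N_add N_scale] by blast
  define f where "f X = g (0, X)" for X
  have f: "linear f"
    using linear_add[OF g(1), of "(0, x)" "(0, y)" for x y]
      linear_scale[OF g(1), of c "(0, x)" for c x]
    by (auto simp: f_def intro!: linearI)
  have f_norm: "f X \<le> 1 * norm X" for X
  proof -
    have "N (0, X) \<le> norm X"
      by (rule N_le) (use q_le[of _ 0 X] in simp)
    then show ?thesis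
      using g(3)[of "(0, X)"] by (simp add: f_def)
  qed
  have f_neg: "f X \<le> 0" if "\<And>h. inner h (X h) \<le> 0" for X :: "'h bop"
  proof -
    have "N (0, X) \<le> 0"
      by (rule N_le) (simp add: q_def cblinfun_apply_ops that)
    then show ?thesis
      using g(3)[of "(0, X)"] by (simp add: f_def)
  qed
  have inner_adj: "inner h (cadjoint X h) = inner h (X h)" for h and X :: "'h bop"
    by (simp add: inner_eq_Re_cinner cadjoint[symmetric]) (subst cinner_commute, simp)
  \<comment> \<open>Skew-adjoint operators have vanishing numerical real part, so \<open>f\<close> only sees
    the self-adjoint part of its argument.\<close>
  have f_adj: "f (cadjoint X) = f X" for X
  proof -
    have "f (cadjoint X - X) \<le> 0" "f (X - cadjoint X) \<le> 0"
      by (rule f_neg, simp add: cblinfun_apply_ops inner_diff_right inner_adj)+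
    then show ?thesis
      by (simp add: linear_diff[OF f])
  qed
  obtain \<psi> :: "'h bop dual" where \<psi>: "\<And>X. cblinfun_apply \<psi> X = Complex (f X) (- f (\<i> *\<^sub>C X))"
    using complexify_functional[OF f f_norm] by blast
  have sq: "inner h ((cadjoint T o\<^sub>C\<^sub>L T) h) = (norm (T h))\<^sup>2" for h and T :: "'h bop"
    by (simp add: cblinfun_compose.rep_eq inner_eq_Re_cinner cadjoint[symmetric] power2_norm_eq_inner)
  have "dual_star \<psi> = \<psi>"
  proof (rule cblinfun_eqI)
    fix X
    have "f (\<i> *\<^sub>C cadjoint X) = f (cadjoint (\<i> *\<^sub>C cadjoint X))"
      by (simp add: f_adj)
    also have "\<dots> = - f (\<i> *\<^sub>C X)"
      using scaleC_of_real[of "-1" "\<i> *\<^sub>C X"]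
      by (simp add: cadjoint_scaleC linear_neg[OF f, symmetric] scaleC_scaleC)
    finally show "dual_star \<psi> X = \<psi> X"
      by (simp add: dual_star.rep_eq \<psi> f_adj complex_eq_iff)
  qed
  moreover have "0 \<le> f (cadjoint T o\<^sub>C\<^sub>L T)" for T
    using f_neg[of "- (cadjoint T o\<^sub>C\<^sub>L T)"] by (simp add: linear_neg[OF f] cblinfun_apply_ops sq)
  ultimately have pos: "positive_functional \<psi>"
    by (simp add: positive_functional_def \<psi>)
  moreover have "norm \<psi> \<le> 1"
    using norm_functional_le[of 1 \<psi> 1] f_norm by (force simp: \<psi> intro: order_trans)
  moreover have "cmod (\<phi> T) \<le> gns_norm \<psi> T" for T
  proof -
    obtain c where c: "cmod c = 1" "Re (\<phi> (c *\<^sub>C T)) = cmod (\<phi> T)"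
      by (rule Re_functional_phase)
    have key: "2 * Re (\<phi> S) - f (cadjoint S o\<^sub>C\<^sub>L S) \<le> 1" for S
    proof -
      have "((S, 0), 2 * Re (\<phi> S)) \<in> G0"
        by (simp add: G0_def)
      then have "2 * Re (\<phi> S) - f (cadjoint S o\<^sub>C\<^sub>L S) = g (S, - (cadjoint S o\<^sub>C\<^sub>L S))"
        using linear_diff[OF g(1), of "(S, 0)" "(0, cadjoint S o\<^sub>C\<^sub>L S)"] g(2) by (simp add: f_def)
      also have "\<dots> \<le> N (S, - (cadjoint S o\<^sub>C\<^sub>L S))"
        by (rule g(3))
      also have "\<dots> \<le> 1"
      proof (rule N_le)
        fix h
        have "0 \<le> (norm (S h) - 1)\<^sup>2"
          by simp
        then show "q (S, - (cadjoint S o\<^sub>C\<^sub>L S)) h \<le> 1"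
          by (simp add: q_def cblinfun_apply_ops sq power2_diff)
      qed
      finally show ?thesis .
    qed
    have "(- cmod (\<phi> T))\<^sup>2 \<le> 1 * f (cadjoint T o\<^sub>C\<^sub>L T)"
    proof (rule quadratic_nonneg_imp)
      fix t :: real
      have tc: "complex_of_real t * c * (complex_of_real t * cnj c) = complex_of_real (t\<^sup>2)"
        using c(1) complex_norm_square[of c] by (simp add: power2_eq_square algebra_simps)
      have "cadjoint (t *\<^sub>R c *\<^sub>C T) o\<^sub>C\<^sub>L (t *\<^sub>R c *\<^sub>C T) = t\<^sup>2 *\<^sub>R (cadjoint T o\<^sub>C\<^sub>L T)"
        by (simp add: scaleC_of_real[symmetric] scaleC_scaleC cadjoint_scaleC cblinfun_compose_linear
            tc[simplified])
      then show "0 \<le> 1 + 2 * t * - cmod (\<phi> T) + t\<^sup>2 * f (cadjoint T o\<^sub>C\<^sub>L T)"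
        using key[of "t *\<^sub>R c *\<^sub>C T"] c(2) by (simp add: cblinfun_apply_scaleR_right linear_scale[OF f])
    next
      show "0 \<le> f (cadjoint T o\<^sub>C\<^sub>L T)"
        by fact
    qed
    then show ?thesis
      unfolding gns_norm_def by (intro real_le_rsqrt) (simp add: \<psi>)
  qed
  ultimately show ?thesis
    by (rule that)
qed

text \<open>By domination \<open>\<phi>\<close> is a bounded functional for the semi-inner product of \<open>\<psi>\<close>, so the approximate
  Riesz theorem applies. Up to \<open>\<epsilon>\<close> this is the representation of \<open>\<phi>\<close> by two vectors of norm at most one in
  a GNS space.\<close>

lemma functional_approx:
  fixes \<phi> :: "('h::complex_hilbert_space) bop dual"
  assumes \<phi>: "norm \<phi> \<le> 1" and \<epsilon>: "0 < \<epsilon>"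
  obtains \<psi> Z where "positive_functional \<psi>" "norm \<psi> \<le> 1" "gns_norm \<psi> Z \<le> 1 + \<epsilon>"
    "norm (\<phi> - arens_dual_op \<psi> (cadjoint Z)) \<le> \<epsilon>"
proof -
  obtain \<psi> where \<psi>: "positive_functional \<psi>" "norm \<psi> \<le> 1" and dom: "\<And>T. cmod (\<phi> T) \<le> gns_norm \<psi> T"
    using functional_dominated[OF \<phi>] by blast
  interpret semi_inner "\<lambda>S T. cblinfun_apply \<psi> (cadjoint S o\<^sub>C\<^sub>L T)"
    by (rule semi_inner_functional[OF \<psi>(1)])
  obtain Z where Z: "\<And>T. cmod (\<phi> T - \<psi> (cadjoint Z o\<^sub>C\<^sub>L T)) \<le> \<epsilon> * gns_norm \<psi> T"
    unfolding gns_norm_def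
  proof (rule approx_riesz[where g = "cblinfun_apply \<phi>" and C = 1, OF _ _ _ \<epsilon>])
    show "cmod (\<phi> T) \<le> 1 * sqrt (Re (\<psi> (cadjoint T o\<^sub>C\<^sub>L T)))" for T
      using dom[of T] by (simp add: gns_norm_def)
  qed (auto simp: cblinfun_apply_right scaleC_complex_def)
  have "gns_norm \<psi> Z \<le> 1 + \<epsilon>"
  proof (cases "gns_norm \<psi> Z = 0")
    case False
    have "gns_norm \<psi> Z * gns_norm \<psi> Z = Re (\<psi> (cadjoint Z o\<^sub>C\<^sub>L Z))"
      using \<psi>(1) by (simp add: gns_norm_def positive_functional_def)
    also have "\<dots> \<le> cmod (\<psi> (cadjoint Z o\<^sub>C\<^sub>L Z))"
      by (rule complex_Re_le_cmod)
    also have "\<dots> \<le> cmod (\<phi> Z) + cmod (\<phi> Z - \<psi> (cadjoint Z o\<^sub>C\<^sub>L Z))"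
      using norm_triangle_ineq4[of "\<phi> Z" "\<phi> Z - \<psi> (cadjoint Z o\<^sub>C\<^sub>L Z)"] by simp
    also have "\<dots> \<le> (1 + \<epsilon>) * gns_norm \<psi> Z"
      using dom[of Z] Z[of Z] by (simp add: algebra_simps)
    finally show ?thesis
      using False gns_norm_nonneg[OF \<psi>(1), of Z] by (simp add: mult_le_cancel_right)
  qed (use \<epsilon> in simp)
  moreover have "norm (\<phi> - arens_dual_op \<psi> (cadjoint Z)) \<le> \<epsilon>"
  proof (rule norm_cblinfun_bound)
    fix T
    have "gns_norm \<psi> T \<le> sqrt (norm \<psi>) * norm T"
      by (rule gns_norm_le[OF \<psi>(1)])
    also have "\<dots> \<le> norm T"
      using \<psi>(2) by (simp add: mult_left_le_one_le)
    finally have "cmod (\<phi> T - \<psi> (cadjoint Z o\<^sub>C\<^sub>L T)) \<le> \<epsilon> * norm T"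
      using Z[of T] mult_left_mono[of "gns_norm \<psi> T" "norm T" \<epsilon>] \<epsilon> by linarith
    then show "norm ((\<phi> - arens_dual_op \<psi> (cadjoint Z)) T) \<le> \<epsilon> * norm T"
      by (simp add: cblinfun_apply_ops arens_dual_op.rep_eq)
  qed (use \<epsilon> in simp)
  ultimately show ?thesis
    using \<psi> that by blast
qed

section \<open>The C*-identity in the bidual\<close>

lemma bidual_eqI:
  fixes \<eta> \<nu> :: "('h::complex_hilbert_space) bop bidual"
  assumes eq: "\<And>\<psi> Z. positive_functional \<psi> \<Longrightarrow> \<eta> (arens_dual_op \<psi> Z) = \<nu> (arens_dual_op \<psi> Z)"
  shows "\<eta> = \<nu>"
proof (rule cblinfun_eqI)
  fix \<phi> :: "'h bop dual"
  define \<phi>' where "\<phi>' = (1 / (norm \<phi> + 1)) *\<^sub>R \<phi>"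
  have pos: "norm \<phi> + 1 > 0"
    by (simp add: add_nonneg_pos)
  have "norm \<phi>' \<le> 1"
    using pos by (simp add: \<phi>'_def)
  have "cmod ((\<eta> - \<nu>) \<phi>') \<le> \<epsilon> * norm (\<eta> - \<nu>)" if "0 < \<epsilon>" "\<epsilon> \<le> 1" for \<epsilon>
  proof -
    obtain \<psi> Z where \<psi>: "positive_functional \<psi>"
      and Z: "norm (\<phi>' - arens_dual_op \<psi> (cadjoint Z)) \<le> \<epsilon>"
      using functional_approx[OF \<open>norm \<phi>' \<le> 1\<close> \<open>0 < \<epsilon>\<close>] by metis
    have "(\<eta> - \<nu>) \<phi>' = (\<eta> - \<nu>) (\<phi>' - arens_dual_op \<psi> (cadjoint Z))"
      by (simp add: cblinfun_apply_right cblinfun_apply_ops eq[OF \<psi>])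
    also have "cmod \<dots> \<le> norm (\<eta> - \<nu>) * norm (\<phi>' - arens_dual_op \<psi> (cadjoint Z))"
      by (rule norm_cblinfun)
    also have "\<dots> \<le> norm (\<eta> - \<nu>) * \<epsilon>"
      by (rule mult_left_mono[OF Z]) simp
    finally show ?thesis
      by (simp add: mult.commute)
  qed
  then have "cmod ((\<eta> - \<nu>) \<phi>') \<le> 0"
    by (rule nonpos_if_le_small_multiples)
  then show "\<eta> \<phi> = \<nu> \<phi>"
    using pos by (simp add: \<phi>'_def cblinfun_apply_ops cblinfun_apply_right)
qed

lemma bidual_star_arens_embed_right:
  "bidual_star (\<eta> \<cdot>\<^sub>A bidual_embed S) = bidual_embed (cadjoint S) \<cdot>\<^sub>A bidual_star \<eta>"
  using arg_cong[OF bidual_star_arens_embed[of "cadjoint S" "bidual_star \<eta>"], of bidual_star] by simp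

text \<open>The identity is known at positive \<open>\<psi>\<close>. A functional \<open>\<psi>(Z \<cdot>)\<close> is reduced to \<open>\<psi>\<close> by absorbing the
  operator \<open>Z\<close> into one of the factors, and such functionals are norm dense.\<close>

theorem bidual_star_arens: "bidual_star (\<eta> \<cdot>\<^sub>A \<nu>) = bidual_star \<nu> \<cdot>\<^sub>A bidual_star \<eta>"
proof (rule bidual_eqI)
  fix \<psi> :: "'a bop dual" and Z :: "'a bop" assume \<psi>: "positive_functional \<psi>"
  let ?Z = "bidual_embed Z"
  have "bidual_star (\<eta> \<cdot>\<^sub>A \<nu>) (arens_dual_op \<psi> Z) = (?Z \<cdot>\<^sub>A bidual_star (\<eta> \<cdot>\<^sub>A \<nu>)) \<psi>"
    by (simp add: arens_embed_left)
  also have "?Z \<cdot>\<^sub>A bidual_star (\<eta> \<cdot>\<^sub>A \<nu>) = bidual_star (\<eta> \<cdot>\<^sub>A (\<nu> \<cdot>\<^sub>A bidual_embed (cadjoint Z)))"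
    by (simp add: bidual_star_arens_embed_right arens_assoc[symmetric])
  also have "\<dots> \<psi> = (bidual_star (\<nu> \<cdot>\<^sub>A bidual_embed (cadjoint Z)) \<cdot>\<^sub>A bidual_star \<eta>) \<psi>"
    by (rule bidual_star_arens_positive[OF \<psi>])
  also have "\<dots> = (?Z \<cdot>\<^sub>A (bidual_star \<nu> \<cdot>\<^sub>A bidual_star \<eta>)) \<psi>"
    by (simp add: bidual_star_arens_embed_right arens_assoc)
  also have "\<dots> = (bidual_star \<nu> \<cdot>\<^sub>A bidual_star \<eta>) (arens_dual_op \<psi> Z)"
    by (simp add: arens_embed_left)
  finally show "bidual_star (\<eta> \<cdot>\<^sub>A \<nu>) (arens_dual_op \<psi> Z) = (bidual_star \<nu> \<cdot>\<^sub>A bidual_star \<eta>) (arens_dual_op \<psi> Z)" .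
qed

text \<open>If \<open>\<phi>\<close> almost attains the norm of \<open>\<eta>\<close> and is close to \<open>\<psi>(Z\<^sup>* \<cdot>)\<close>, then \<open>\<eta>(\<phi>)\<close> is close to the inner
  product of \<open>Z\<close> and \<open>\<eta>\<close>, to which the Cauchy-Schwarz inequality applies. Besides the
  C*-inequality this provides the positive functionals by which the sizes of positive elements can be compared.\<close>

lemma norm_bidual_attained_approx:
  fixes \<eta> :: "('h::complex_hilbert_space) bop bidual"
  assumes \<epsilon>: "0 < \<epsilon>"
  obtains \<psi> where "positive_functional \<psi>" "norm \<psi> \<le> 1"
    "norm \<eta> \<le> sqrt (Re ((bidual_star \<eta> \<cdot>\<^sub>A \<eta>) \<psi>)) + \<epsilon>"
proof -
  have "\<exists>\<phi>. norm \<phi> \<le> 1 \<and> norm \<eta> - \<epsilon> / 2 < Re (\<eta> \<phi>)"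
  proof (rule ccontr)
    assume "\<not> ?thesis"
    then have "1 * norm \<eta> \<le> norm \<eta> - \<epsilon> / 2"
      by (intro norm_functional_le) (auto simp: not_less)
    then show False
      using \<epsilon> by simp
  qed
  then obtain \<phi> where \<phi>: "norm \<phi> \<le> 1" "norm \<eta> - \<epsilon> / 2 < Re (\<eta> \<phi>)"
    by blast
  define \<delta> where "\<delta> = \<epsilon> / (4 * norm \<eta> + 4)"
  have den: "4 * norm \<eta> + 4 > 0"
    by (simp add: add_nonneg_pos)
  then have \<delta>: "0 < \<delta>" "2 * norm \<eta> * \<delta> \<le> \<epsilon> / 2"
    using \<epsilon> by (simp_all add: \<delta>_def field_simps)
  obtain \<psi> Z where \<psi>: "positive_functional \<psi>" "norm \<psi> \<le> 1" "gns_norm \<psi> Z \<le> 1 + \<delta>"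
    and Z: "norm (\<phi> - arens_dual_op \<psi> (cadjoint Z)) \<le> \<delta>"
    using functional_approx[OF \<phi>(1) \<delta>(1)] by blast
  define s where "s = sqrt (Re ((bidual_star \<eta> \<cdot>\<^sub>A \<eta>) \<psi>))"
  have s: "0 \<le> s" "s \<le> norm \<eta>"
  proof -
    show "0 \<le> s"
      using arens_star_square_nonneg[OF \<psi>(1)] by (simp add: s_def)
    have "Re ((bidual_star \<eta> \<cdot>\<^sub>A \<eta>) \<psi>) \<le> norm (bidual_star \<eta> \<cdot>\<^sub>A \<eta>) * norm \<psi>"
      using complex_Re_le_cmod norm_cblinfun by (rule order_trans)
    also have "\<dots> \<le> (norm \<eta> * norm \<eta>) * 1"
      by (intro mult_mono \<psi> order_trans[OF norm_arens] norm_bidual_star) auto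
    finally show "s \<le> norm \<eta>"
      unfolding s_def by (intro real_le_lsqrt) (auto simp: power2_eq_square)
  qed
  have "cmod (\<eta> (arens_dual_op \<psi> (cadjoint Z))) \<le> gns_norm \<psi> Z * s"
    using semi_inner.cauchy_schwarz_sqrt[OF semi_inner_bidual[OF \<psi>(1)], of "bidual_embed Z" \<eta>]
    by (simp add: bidual_star_embed arens_bidual_embed bidual_embed.rep_eq arens_embed_left
        gns_norm_def s_def)
  also have "\<dots> \<le> (1 + \<delta>) * s"
    by (rule mult_right_mono[OF \<psi>(3) s(1)])
  also have "\<dots> \<le> s + \<delta> * norm \<eta>"
    using s \<delta> by (simp add: distrib_right mult_left_mono)
  finally have 1: "cmod (\<eta> (arens_dual_op \<psi> (cadjoint Z))) \<le> s + \<delta> * norm \<eta>" .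
  have "cmod (\<eta> (\<phi> - arens_dual_op \<psi> (cadjoint Z))) \<le> norm \<eta> * \<delta>"
    using norm_cblinfun mult_left_mono[OF Z norm_ge_zero] by (rule order_trans)
  then have "cmod (\<eta> \<phi>) \<le> s + 2 * norm \<eta> * \<delta>"
    using 1 norm_triangle_sub[of "\<eta> \<phi>" "\<eta> (arens_dual_op \<psi> (cadjoint Z))"]
    by (simp add: cblinfun_apply_right algebra_simps)
  then have "norm \<eta> \<le> s + \<epsilon>"
    using \<phi>(2) \<delta>(2) complex_Re_le_cmod[of "\<eta> \<phi>"] by linarith
  then show ?thesis
    using that[OF \<psi>(1,2)] by (simp add: s_def)
qed

theorem cstar_inequality:
  fixes \<eta> :: "('h::complex_hilbert_space) bop bidual"
  shows "(norm \<eta>)\<^sup>2 \<le> norm (bidual_star \<eta> \<cdot>\<^sub>A \<eta>)"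
proof -
  have "norm \<eta> \<le> sqrt (norm (bidual_star \<eta> \<cdot>\<^sub>A \<eta>)) + \<epsilon>" if \<epsilon>: "0 < \<epsilon>" for \<epsilon>
  proof -
    obtain \<psi> where \<psi>: "positive_functional \<psi>" "norm \<psi> \<le> 1"
      "norm \<eta> \<le> sqrt (Re ((bidual_star \<eta> \<cdot>\<^sub>A \<eta>) \<psi>)) + \<epsilon>"
      using norm_bidual_attained_approx[OF \<epsilon>] by blast
    have "Re ((bidual_star \<eta> \<cdot>\<^sub>A \<eta>) \<psi>) \<le> norm (bidual_star \<eta> \<cdot>\<^sub>A \<eta>) * norm \<psi>"
      using complex_Re_le_cmod norm_cblinfun by (rule order_trans)
    also have "\<dots> \<le> norm (bidual_star \<eta> \<cdot>\<^sub>A \<eta>)"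
      by (rule mult_left_le[OF \<psi>(2)]) simp
    finally show ?thesis
      using \<psi>(3) by (smt (verit) real_sqrt_le_mono)
  qed
  then have "norm \<eta> \<le> sqrt (norm (bidual_star \<eta> \<cdot>\<^sub>A \<eta>))"
    by (rule field_le_epsilon)
  then have "(norm \<eta>)\<^sup>2 \<le> (sqrt (norm (bidual_star \<eta> \<cdot>\<^sub>A \<eta>)))\<^sup>2"
    by (intro power_mono) auto
  then show ?thesis
    by simp
qed

section \<open>Completeness and successive approximation\<close>

instance cblinfun ::
    (complex_normed_vector, "{complex_normed_vector, complete_space}") complete_space
proof
  fix X :: "nat \<Rightarrow> 'a \<Rightarrow>\<^sub>C\<^sub>L 'b" assume X: "Cauchy X"
  have ptwise: "norm (X m x - X n x) \<le> norm (X m - X n) * norm x" for m n x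
    using norm_cblinfun[of "X m - X n" x] by (simp add: cblinfun_apply_ops)
  have unif: "\<exists>N. \<forall>m\<ge>N. \<forall>n\<ge>N. norm (X m - X n) \<le> e" if "0 < e" for e
    using X that unfolding Cauchy_def dist_norm by (meson less_imp_le)
  have "\<exists>y. (\<lambda>n. X n x) \<longlonglongrightarrow> y" for x
  proof -
    have "Cauchy (\<lambda>n. X n x)"
    proof (rule metric_CauchyI)
      fix e :: real assume e: "0 < e"
      have x1: "norm x + 1 > 0"
        by (simp add: add_nonneg_pos)
      then obtain N where N: "\<And>m n. N \<le> m \<Longrightarrow> N \<le> n \<Longrightarrow> norm (X m - X n) \<le> e / (norm x + 1)"
        using unif[of "e / (norm x + 1)"] e by (meson divide_pos_pos)
      have "dist (X m x) (X n x) < e" if "N \<le> m" "N \<le> n" for m n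
      proof -
        have "norm (X m x - X n x) \<le> e / (norm x + 1) * norm x"
          using ptwise mult_right_mono[OF N[OF that] norm_ge_zero[of x]] by (rule order_trans)
        also have "\<dots> < e"
          using e x1 by (simp add: divide_less_eq)
        finally show ?thesis
          by (simp add: dist_norm)
      qed
      then show "\<exists>N. \<forall>m\<ge>N. \<forall>n\<ge>N. dist (X m x) (X n x) < e"
        by blast
    qed
    then show ?thesis
      by (simp add: Cauchy_convergent flip: convergent_def)
  qed
  then obtain L where L: "\<And>x. (\<lambda>n. X n x) \<longlonglongrightarrow> L x"
    by metis
  have close: "norm (X m x - L x) \<le> e * norm x"
    if N: "\<And>m n. N \<le> m \<Longrightarrow> N \<le> n \<Longrightarrow> norm (X m - X n) \<le> e" and m: "N \<le> m" for N m e x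
  proof (rule LIMSEQ_le_const2[OF tendsto_norm[OF tendsto_diff[OF tendsto_const L]]])
    have "norm (X m x - X n x) \<le> e * norm x" if "N \<le> n" for n
      using ptwise mult_right_mono[OF N[OF m that] norm_ge_zero[of x]] by (rule order_trans)
    then show "\<exists>N. \<forall>n\<ge>N. norm (X m x - X n x) \<le> e * norm x"
      by blast
  qed
  obtain N where N: "\<And>m n. N \<le> m \<Longrightarrow> N \<le> n \<Longrightarrow> norm (X m - X n) \<le> 1"
    using unif[of 1] by (meson zero_less_one)
  have "bounded_clinear L"
  proof (rule bounded_clinearI)
    show "L (x + y) = L x + L y" for x y
      using tendsto_add[OF L[of x] L[of y]] L[of "x + y"]
      by (simp add: cblinfun_apply_right LIMSEQ_unique)
    show "L (c *\<^sub>C x) = c *\<^sub>C L x" for c x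
      using bounded_linear.tendsto[OF bounded_linear_scaleC L[of x], of c] L[of "c *\<^sub>C x"]
      by (simp add: cblinfun_apply_right LIMSEQ_unique)
    show "norm (L x) \<le> norm x * (norm (X N) + 1)" for x
    proof -
      have "norm (L x) \<le> norm (X N x) + norm (X N x - L x)"
        using norm_triangle_ineq4[of "X N x" "X N x - L x"] by simp
      also have "\<dots> \<le> norm (X N) * norm x + 1 * norm x"
        by (intro add_mono norm_cblinfun close[OF N]) auto
      finally show ?thesis
        by (simp add: algebra_simps)
    qed
  qed
  then have L': "cblinfun_apply (CBlinfun L) = L"
    by (simp add: CBlinfun_inverse)
  have "X \<longlonglongrightarrow> CBlinfun L"
  proof (rule metric_LIMSEQ_I)
    fix e :: real assume e: "0 < e"
    then obtain N where N: "\<And>m n. N \<le> m \<Longrightarrow> N \<le> n \<Longrightarrow> norm (X m - X n) \<le> e / 2"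
      using unif[of "e / 2"] by (meson half_gt_zero)
    have "norm (X n - CBlinfun L) \<le> e / 2" if "N \<le> n" for n
      by (rule norm_cblinfun_bound)
        (use e close[OF N that] in \<open>simp_all add: cblinfun_apply_ops L'\<close>)
    then show "\<exists>N. \<forall>n\<ge>N. dist (X n) (CBlinfun L) < e"
      using e by (force simp: dist_norm)
  qed
  then show "convergent X"
    by (rule convergentI)
qed

text \<open>The errors are taken to be \<open>\<epsilon> / 4 ^ n\<close>, so that the corrections, of order \<open>sqrt \<epsilon> / 2 ^ n\<close>, are
  summable.\<close>

lemma successive_correction:
  fixes u x\<^sub>0 :: "'a::{real_normed_vector, complete_space}"
  assumes M: "closed M"
    and step: "\<And>x \<epsilon> \<tau>. x \<in> M \<Longrightarrow> 0 < \<epsilon> \<Longrightarrow> \<epsilon> \<le> 1 \<Longrightarrow> 0 < \<tau> \<Longrightarrow> norm (u - x) \<le> d + \<epsilon> \<Longrightarrow>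
      \<exists>x'\<in>M. norm (u - x') \<le> d + \<tau> \<and> norm (x' - x) \<le> C * sqrt \<epsilon>"
    and x0: "x\<^sub>0 \<in> M" "norm (u - x\<^sub>0) \<le> d + \<epsilon>" and \<epsilon>: "0 < \<epsilon>" "\<epsilon> \<le> 1"
  obtains x where "x \<in> M" "norm (u - x) \<le> d" "norm (x - x\<^sub>0) \<le> 2 * C * sqrt \<epsilon>"
proof -
  \<comment> \<open>The clause for \<open>n = 0\<close> pins the start of the sequence, which dependent choice would leave open.\<close>
  let ?P = "\<lambda>n x. x \<in> M \<and> norm (u - x) \<le> d + \<epsilon> / 4 ^ n \<and> (n = 0 \<longrightarrow> x = x\<^sub>0)"
  let ?Q = "\<lambda>n x x'. norm (x' - x) \<le> C * sqrt \<epsilon> / 2 ^ n"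
  have "\<exists>X. \<forall>n. ?P n (X n) \<and> ?Q n (X n) (X (Suc n))"
  proof (rule dependent_nat_choice)
    show "\<exists>x. ?P 0 x"
      using x0 by auto
    fix x n assume x: "?P n x"
    have "\<epsilon> / 4 ^ n \<le> 1"
      using \<epsilon> by (simp add: divide_le_eq) (meson one_le_power order_trans one_le_numeral)
    then obtain x' where "x' \<in> M" "norm (u - x') \<le> d + \<epsilon> / 4 ^ Suc n"
      "norm (x' - x) \<le> C * sqrt (\<epsilon> / 4 ^ n)"
      using step[of x "\<epsilon> / 4 ^ n" "\<epsilon> / 4 ^ Suc n"] x \<epsilon> by auto
    moreover have "sqrt ((4::real) ^ n) = 2 ^ n"
      by (simp add: real_sqrt_power)
    ultimately show "\<exists>x'. ?P (Suc n) x' \<and> ?Q n x x'"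
      by (auto simp: real_sqrt_divide)
  qed
  then obtain X where X: "\<And>n. X n \<in> M" "\<And>n. norm (u - X n) \<le> d + \<epsilon> / 4 ^ n" "X 0 = x\<^sub>0"
    and X_step: "\<And>n. norm (X (Suc n) - X n) \<le> C * sqrt \<epsilon> / 2 ^ n"
    by (metis (no_types, lifting))
  define K where "K = 2 * C * sqrt \<epsilon>"
  have tail: "norm (X (n + k) - X n) \<le> K / 2 ^ n * (1 - 1 / 2 ^ k)" for n k
  proof (induction k)
    case (Suc k)
    have "norm (X (n + Suc k) - X n) \<le> norm (X (Suc (n + k)) - X (n + k)) + norm (X (n + k) - X n)"
      using norm_triangle_ineq[of "X (Suc (n + k)) - X (n + k)" "X (n + k) - X n"] by simp
    also have "\<dots> \<le> C * sqrt \<epsilon> / 2 ^ (n + k) + K / 2 ^ n * (1 - 1 / 2 ^ k)"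
      by (intro add_mono X_step Suc.IH)
    also have "\<dots> = K / 2 ^ n * (1 - 1 / 2 ^ Suc k)"
      by (simp add: K_def power_add field_simps)
    finally show ?case .
  qed simp
  have "0 \<le> C * sqrt \<epsilon> / 2 ^ 0"
    using norm_ge_zero X_step by (rule order_trans)
  then have K: "0 \<le> K"
    by (simp add: K_def)
  have tail': "norm (X (n + k) - X n) \<le> K / 2 ^ n" for n k
    using tail[of n k] mult_left_mono[of "1 - 1 / 2 ^ k" 1 "K / 2 ^ n"] K by simp
  have "Cauchy X"
    unfolding Cauchy_altdef2
  proof (intro allI impI)
    fix e :: real assume e: "0 < e"
    then obtain N where N: "(1 / 2) ^ N < e / (K + 1)"
      using real_arch_pow_inv[of "e / (K + 1)" "1 / 2"] K by auto
    have "K / 2 ^ N \<le> (K + 1) * (1 / 2) ^ N"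
      by (simp add: power_one_over field_simps)
    also have "\<dots> < e"
      using N K by (simp add: field_simps)
    finally have "dist (X n) (X N) < e" if "N \<le> n" for n
      using tail'[of N "n - N"] that by (simp add: dist_norm)
    then show "\<exists>N. \<forall>n\<ge>N. dist (X n) (X N) < e"
      by blast
  qed
  then obtain x where x: "X \<longlonglongrightarrow> x"
    using Cauchy_convergent unfolding convergent_def by metis
  show ?thesis
  proof
    show "x \<in> M"
      by (rule closed_sequentially[OF M X(1) x])
    have "(\<lambda>n. d + \<epsilon> * (1 / 4) ^ n) \<longlonglongrightarrow> d + \<epsilon> * 0"
      by (intro tendsto_intros LIMSEQ_realpow_zero) auto
    then have "(\<lambda>n. d + \<epsilon> / 4 ^ n) \<longlonglongrightarrow> d"
      by (simp add: power_one_over)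
    from LIMSEQ_le[OF tendsto_norm[OF tendsto_diff[OF tendsto_const x]] this]
    show "norm (u - x) \<le> d"
      using X(2) by simp
    show "norm (x - x\<^sub>0) \<le> 2 * C * sqrt \<epsilon>"
    proof (rule LIMSEQ_le_const2[OF tendsto_norm[OF tendsto_diff[OF x tendsto_const]]])
      show "\<exists>N. \<forall>n\<ge>N. norm (X n - x\<^sub>0) \<le> 2 * C * sqrt \<epsilon>"
        using tail'[of 0] X(3) by (simp add: K_def)
    qed
  qed
qed

section \<open>Norm estimates with projections\<close>

lemma projectionD:
  assumes "projection p"
  shows "p \<cdot>\<^sub>A p = p" "bidual_star p = p" "p \<cdot>\<^sub>A (p \<cdot>\<^sub>A \<eta>) = p \<cdot>\<^sub>A \<eta>"
  using assms by (simp_all add: projection_def arens_assoc[symmetric])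

lemma projection_complement: "projection p \<Longrightarrow> projection (bidual_one - p)"
  by (simp add: projection_def arens_linear bidual_star_ops)

lemma norm_projection_le_one:
  assumes "projection p"
  shows "norm p \<le> 1"
proof -
  have "norm p * norm p \<le> 1 * norm p"
    using cstar_inequality[of p] projectionD[OF assms] by (simp add: power2_eq_square)
  then show ?thesis
    by (cases "norm p = 0") (simp_all add: mult_le_cancel_right)
qed

lemma arens_zero [simp]: "0 \<cdot>\<^sub>A \<eta> = 0" "\<eta> \<cdot>\<^sub>A 0 = 0"
  using arens_linear(3)[of 0 0 \<eta>] arens_linear(7)[of \<eta> 0 0] by simp_all

text \<open>Orthogonality passes to \<open>\<alpha>\<^sup>*\<alpha>\<close> and \<open>\<beta>\<^sup>*\<beta>\<close>, whose sum is \<open>(\<alpha> + \<beta>)\<^sup>*(\<alpha> + \<beta>)\<close>. Repeated use of the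
  C*-inequality thus shows, for \<open>r = 1\<close>, that the powers \<open>\<parallel>\<alpha> + \<beta>\<parallel> ^ 2 ^ n\<close> stay below the trivial bound
  \<open>1 + 1\<close>; a nonnegative number with bounded powers is at most \<open>1\<close>.\<close>

lemma norm_orthogonal_sum_le:
  assumes orth: "bidual_star \<alpha> \<cdot>\<^sub>A \<beta> = 0" "\<alpha> \<cdot>\<^sub>A bidual_star \<beta> = 0"
    and norms: "norm \<alpha> \<le> r" "norm \<beta> \<le> r"
  shows "norm (\<alpha> + \<beta>) \<le> r"
proof -
  have unit_power: "norm (\<alpha> + \<beta>) ^ 2 ^ n \<le> 2"
    if "bidual_star \<alpha> \<cdot>\<^sub>A \<beta> = 0" "\<alpha> \<cdot>\<^sub>A bidual_star \<beta> = 0" "norm \<alpha> \<le> 1" "norm \<beta> \<le> 1"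
    for n and \<alpha> \<beta> :: "'a bop bidual"
    using that
  proof (induction n arbitrary: \<alpha> \<beta>)
    case 0
    then show ?case
      using norm_triangle_ineq[of \<alpha> \<beta>] by simp
  next
    case (Suc n)
    let ?a = "bidual_star \<alpha> \<cdot>\<^sub>A \<alpha>" and ?b = "bidual_star \<beta> \<cdot>\<^sub>A \<beta>"
    have "bidual_star \<beta> \<cdot>\<^sub>A \<alpha> = bidual_star (bidual_star \<alpha> \<cdot>\<^sub>A \<beta>)"
      by (simp add: bidual_star_arens)
    then have ba: "bidual_star \<beta> \<cdot>\<^sub>A \<alpha> = 0"
      using Suc.prems(1) bidual_star_ops(3)[of 0 0] by simp
    have "?a \<cdot>\<^sub>A ?b = bidual_star \<alpha> \<cdot>\<^sub>A ((\<alpha> \<cdot>\<^sub>A bidual_star \<beta>) \<cdot>\<^sub>A \<beta>)"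
      by (simp only: arens_assoc)
    then have ab: "?a \<cdot>\<^sub>A ?b = 0"
      by (simp add: Suc.prems(2))
    have star_le: "norm (bidual_star \<gamma> \<cdot>\<^sub>A \<gamma>) \<le> 1" if "norm \<gamma> \<le> 1" for \<gamma> :: "'a bop bidual"
      using that norm_bidual_star[of \<gamma>]
      by (intro order_trans[OF norm_arens]) (simp add: mult_le_one)
    have "norm (\<alpha> + \<beta>) ^ 2 ^ Suc n = ((norm (\<alpha> + \<beta>))\<^sup>2) ^ 2 ^ n"
      by (simp add: power_mult)
    also have "\<dots> \<le> norm (bidual_star (\<alpha> + \<beta>) \<cdot>\<^sub>A (\<alpha> + \<beta>)) ^ 2 ^ n"
      by (intro power_mono cstar_inequality) simp
    also have "bidual_star (\<alpha> + \<beta>) \<cdot>\<^sub>A (\<alpha> + \<beta>) = ?a + ?b"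
      by (simp add: bidual_star_ops arens_linear Suc.prems(1) ba)
    also have "norm (?a + ?b) ^ 2 ^ n \<le> 2"
      using ab Suc.prems by (intro Suc.IH star_le) (simp_all add: bidual_star_arens)
    finally show ?case .
  qed
  show ?thesis
  proof (cases "r = 0")
    case True
    then show ?thesis
      using norms by simp
  next
    case False
    then have r: "0 < r"
      using norms(1) norm_ge_zero[of \<alpha>] by linarith
    define x where "x = norm ((1 / r) *\<^sub>R \<alpha> + (1 / r) *\<^sub>R \<beta>)"
    have x_power: "x ^ 2 ^ n \<le> 2" for n
      unfolding x_def using r norms
      by (intro unit_power) (simp_all add: bidual_star_ops arens_linear orth)
    have "x \<le> 1"
    proof (rule ccontr)
      assume x: "\<not> x \<le> 1"
      then obtain n where "2 < x ^ n"
        using real_arch_pow[of x 2] by auto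
      also have "x ^ n \<le> x ^ 2 ^ n"
        using x by (intro power_increasing) (auto intro: less_imp_le)
      finally show False
        using x_power[of n] by simp
    qed
    moreover have "x = norm (\<alpha> + \<beta>) / r"
      using r by (simp add: x_def flip: scaleR_add_right)
    ultimately show ?thesis
      using r by (simp add: divide_le_eq)
  qed
qed

text \<open>Here \<open>(q + s)\<^sup>*(q + s) = q + s\<^sup>*s\<close>, and \<open>h = s\<^sup>*s\<close> lives under \<open>q\<close>. A positive functional that almost
  attains \<open>\<parallel>h\<parallel>\<close> has almost its whole mass on \<open>q\<close>, by the Cauchy-Schwarz inequality for \<open>h = hq\<close>. Its value at
  \<open>q + h\<close> is thus almost \<open>1 + \<parallel>h\<parallel>\<close>, and it is at most \<open>M\<^sup>2\<close>.\<close>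

lemma norm_projection_column:
  assumes q: "projection q" and s: "s \<cdot>\<^sub>A q = s" "q \<cdot>\<^sub>A s = 0"
    and M: "norm (q + s) \<le> M" "1 \<le> M"
  shows "(norm s)\<^sup>2 \<le> M\<^sup>2 - 1"
proof (cases "norm s = 0")
  case True
  then show ?thesis
    using M by (simp add: power2_eq_square mult_ge1_I)
next
  case False
  define \<sigma> where "\<sigma> = norm s"
  have \<sigma>: "0 < \<sigma>"
    using False by (simp add: \<sigma>_def)
  define h where "h = bidual_star s \<cdot>\<^sub>A s"
  have "bidual_star s \<cdot>\<^sub>A q = bidual_star (q \<cdot>\<^sub>A s)"
    by (simp add: bidual_star_arens projectionD[OF q])
  then have sq: "bidual_star s \<cdot>\<^sub>A q = 0"
    using s(2) bidual_star_ops(3)[of 0 0] by simp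
  have square: "bidual_star (q + s) \<cdot>\<^sub>A (q + s) = q + h"
    by (simp add: bidual_star_ops arens_linear projectionD[OF q] s(2) sq h_def)
  have h: "bidual_star h = h" "h \<cdot>\<^sub>A q = h"
    by (simp_all add: h_def bidual_star_arens arens_assoc s(1))
  have norm_h: "norm h \<le> \<sigma>\<^sup>2"
    using norm_arens[of "bidual_star s" s] mult_right_mono[OF norm_bidual_star[of s], of "norm s"]
    by (simp add: h_def \<sigma>_def power2_eq_square)
  have norm_qh: "norm (q + h) \<le> M\<^sup>2"
  proof -
    have "norm (q + h) \<le> norm (bidual_star (q + s)) * norm (q + s)"
      unfolding square[symmetric] by (rule norm_arens)
    also have "\<dots> \<le> norm (q + s) * norm (q + s)"
      by (intro mult_right_mono norm_bidual_star) simp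
    also have "\<dots> \<le> M * M"
      using M by (intro mult_mono) auto
    finally show ?thesis
      by (simp add: power2_eq_square)
  qed
  have "\<sigma>\<^sup>2 + 1 - M\<^sup>2 \<le> \<epsilon> * (2 * \<sigma> * (1 + 2 / \<sigma>\<^sup>2))" if \<epsilon>: "0 < \<epsilon>" "\<epsilon> \<le> 1" for \<epsilon>
  proof -
    obtain \<psi> where \<psi>: "positive_functional \<psi>" "norm \<psi> \<le> 1" "\<sigma> \<le> sqrt (Re (h \<psi>)) + \<epsilon>"
      using norm_bidual_attained_approx[OF \<epsilon>(1), of s] unfolding \<sigma>_def h_def by blast
    interpret semi_inner "\<lambda>\<eta> \<nu>. cblinfun_apply (bidual_star \<eta> \<cdot>\<^sub>A \<nu>) \<psi>"
      by (rule semi_inner_bidual[OF \<psi>(1)])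
    have le_norm: "Re (\<eta> \<psi>) \<le> norm \<eta>" for \<eta> :: "'a bop bidual"
      using complex_Re_le_cmod[of "\<eta> \<psi>"] norm_cblinfun[of \<eta> \<psi>]
        mult_left_le[OF \<psi>(2) norm_ge_zero[of \<eta>]] by linarith
    define x where "x = Re (h \<psi>)"
    define y where "y = Re (q \<psi>)"
    have x: "0 \<le> x" "x \<le> \<sigma>\<^sup>2"
      using pos[of s] le_norm[of h] norm_h by (simp_all add: x_def h_def)
    have y: "0 \<le> y"
      using pos[of q] by (simp add: y_def projectionD[OF q])
    have "x\<^sup>2 \<le> (cmod (h \<psi>))\<^sup>2"
      using x abs_Re_le_cmod[of "h \<psi>"] by (intro power_mono) (simp_all add: x_def)
    also have "\<dots> \<le> Re ((h \<cdot>\<^sub>A h) \<psi>) * y"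
      using cauchy_schwarz[of h q] by (simp add: h y_def projectionD[OF q])
    also have "\<dots> \<le> (\<sigma>\<^sup>2)\<^sup>2 * y"
    proof (rule mult_right_mono[OF _ y])
      have "Re ((h \<cdot>\<^sub>A h) \<psi>) \<le> norm h * norm h"
        using le_norm norm_arens by (rule order_trans)
      also have "\<dots> \<le> \<sigma>\<^sup>2 * \<sigma>\<^sup>2"
        using norm_h by (intro mult_mono) auto
      finally show "Re ((h \<cdot>\<^sub>A h) \<psi>) \<le> (\<sigma>\<^sup>2)\<^sup>2"
        by (simp add: power2_eq_square)
    qed
    finally have y_ge: "(x / \<sigma>\<^sup>2)\<^sup>2 \<le> y"
      using \<sigma> by (simp add: power_divide divide_le_eq mult.commute)
    have "x + y \<le> M\<^sup>2"
      using le_norm[of "q + h"] norm_qh by (simp add: x_def y_def cblinfun_apply_ops)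
    then have "\<sigma>\<^sup>2 + 1 - M\<^sup>2 \<le> (\<sigma>\<^sup>2 - x) + (1 - (x / \<sigma>\<^sup>2)\<^sup>2)"
      using y_ge by linarith
    also have "1 - (x / \<sigma>\<^sup>2)\<^sup>2 = (1 - x / \<sigma>\<^sup>2) * (1 + x / \<sigma>\<^sup>2)"
      by (simp add: power2_eq_square algebra_simps)
    also have "\<dots> \<le> (1 - x / \<sigma>\<^sup>2) * 2"
      using x \<sigma> by (intro mult_left_mono) (simp_all add: divide_le_eq)
    also have "(\<sigma>\<^sup>2 - x) + (1 - x / \<sigma>\<^sup>2) * 2 = (\<sigma>\<^sup>2 - x) * (1 + 2 / \<sigma>\<^sup>2)"
      using \<sigma> by (simp add: field_simps)
    also have "\<dots> \<le> (\<epsilon> * (2 * \<sigma>)) * (1 + 2 / \<sigma>\<^sup>2)"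
    proof (rule mult_right_mono)
      have "sqrt x \<le> \<sigma>"
        using x \<sigma> by (intro real_le_lsqrt) auto
      have "\<sigma>\<^sup>2 - x = (\<sigma> - sqrt x) * (\<sigma> + sqrt x)"
        using x by (simp add: power2_eq_square algebra_simps)
      also have "\<dots> \<le> \<epsilon> * (2 * \<sigma>)"
        using \<psi>(3) \<epsilon> \<sigma> x \<open>sqrt x \<le> \<sigma>\<close> by (intro mult_mono) (simp_all add: x_def)
      finally show "\<sigma>\<^sup>2 - x \<le> \<epsilon> * (2 * \<sigma>)" .
    qed simp
    finally show ?thesis
      by (simp add: mult.assoc)
  qed
  then have "\<sigma>\<^sup>2 + 1 - M\<^sup>2 \<le> 0"
    by (rule nonpos_if_le_small_multiples)
  then show ?thesis
    by (simp add: \<sigma>_def)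
qed

section \<open>The ideals attached to an open projection\<close>

lemma alg_bidualI:
  "(\<And>\<phi>. (\<And>a. a \<in> S \<Longrightarrow> cblinfun_apply \<phi> a = 0) \<Longrightarrow> cblinfun_apply \<eta> \<phi> = 0) \<Longrightarrow> \<eta> \<in> alg_bidual S"
  by (auto simp: alg_bidual_def)

lemma alg_bidual_ops:
  "\<eta> \<in> alg_bidual S \<Longrightarrow> \<nu> \<in> alg_bidual S \<Longrightarrow> \<eta> - \<nu> \<in> alg_bidual S"
  "\<eta> \<in> alg_bidual S \<Longrightarrow> r *\<^sub>R \<eta> \<in> alg_bidual S"
  by (auto simp: alg_bidual_def cblinfun_apply_ops)

lemma embed_in_alg_bidual: "a \<in> S \<Longrightarrow> bidual_embed a \<in> alg_bidual S"
  by (auto simp: alg_bidual_def bidual_embed.rep_eq)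

lemma continuous_arens_embed:
  "continuous_on UNIV (\<lambda>x. \<eta> \<cdot>\<^sub>A bidual_embed x)" "continuous_on UNIV (\<lambda>x. bidual_embed x \<cdot>\<^sub>A \<eta>)"
proof -
  have "bounded_linear (\<lambda>x. \<eta> \<cdot>\<^sub>A bidual_embed x)"
  proof (rule bounded_linear_intro)
    show "norm (\<eta> \<cdot>\<^sub>A bidual_embed x) \<le> norm x * norm \<eta>" for x
      using norm_arens[of \<eta> "bidual_embed x"] mult_left_mono[OF norm_bidual_embed[of x], of "norm \<eta>"]
      by (simp add: mult.commute)
  qed (simp_all add: bidual_embed_ops arens_linear)
  then show "continuous_on UNIV (\<lambda>x. \<eta> \<cdot>\<^sub>A bidual_embed x)"
    by (rule linear_continuous_on)
  have "bounded_linear (\<lambda>x. bidual_embed x \<cdot>\<^sub>A \<eta>)"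
  proof (rule bounded_linear_intro)
    show "norm (bidual_embed x \<cdot>\<^sub>A \<eta>) \<le> norm x * norm \<eta>" for x
      using norm_arens[of "bidual_embed x" \<eta>] mult_right_mono[OF norm_bidual_embed[of x], of "norm \<eta>"]
      by simp
  qed (simp_all add: bidual_embed_ops arens_linear)
  then show "continuous_on UNIV (\<lambda>x. bidual_embed x \<cdot>\<^sub>A \<eta>)"
    by (rule linear_continuous_on)
qed

locale open_projection_in =
  fixes A :: "('h::complex_hilbert_space) bop set" and p :: "'h bop bidual"
  assumes algebra: "operator_algebra A" and open_p: "open_projection A p"
begin

lemma A_closed_ops:
  "0 \<in> A" "S \<in> A \<Longrightarrow> T \<in> A \<Longrightarrow> S + T \<in> A" "S \<in> A \<Longrightarrow> c *\<^sub>C S \<in> A"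
  "S \<in> A \<Longrightarrow> T \<in> A \<Longrightarrow> S o\<^sub>C\<^sub>L T \<in> A" "closed A"
  using algebra by (auto simp: operator_algebra_def)

lemma A_scaleR: "S \<in> A \<Longrightarrow> r *\<^sub>R S \<in> A"
  using A_closed_ops(3)[of S "complex_of_real r"] by (simp add: scaleC_of_real)

lemma A_diff: "S \<in> A \<Longrightarrow> T \<in> A \<Longrightarrow> S - T \<in> A"
  using A_closed_ops(2)[of S "(- 1) *\<^sub>R T"] A_scaleR[of T "- 1"] by simp

definition q :: "'h bop bidual" where "q = bidual_one - p"

lemma projection_p: "projection p"
  using open_p by (simp add: open_projection_def)

lemma projection_q: "projection q"
  unfolding q_def by (rule projection_complement[OF projection_p])

lemma pq: "p \<cdot>\<^sub>A q = 0" "q \<cdot>\<^sub>A p = 0" "p \<cdot>\<^sub>A (q \<cdot>\<^sub>A \<eta>) = 0" "q \<cdot>\<^sub>A (p \<cdot>\<^sub>A \<eta>) = 0"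
  by (simp_all add: q_def arens_linear projectionD[OF projection_p])

definition R :: "'h bop set" where "R = {x \<in> A. p \<cdot>\<^sub>A bidual_embed x = bidual_embed x}"

text \<open>The hereditary subalgebra of \<open>A\<close> supported by \<open>p\<close>. It lies in the left ideal, and the distance from
  \<open>b\<close> will be attained in it.\<close>

definition D :: "'h bop set" where "D = {x \<in> R. bidual_embed x \<cdot>\<^sub>A p = bidual_embed x}"

lemma R_A: "x \<in> R \<Longrightarrow> x \<in> A" and R_p: "x \<in> R \<Longrightarrow> p \<cdot>\<^sub>A bidual_embed x = bidual_embed x"
  by (simp_all add: R_def)

lemma R_ops:
  "0 \<in> R" "x \<in> R \<Longrightarrow> y \<in> R \<Longrightarrow> x + y \<in> R" "x \<in> R \<Longrightarrow> c *\<^sub>C x \<in> R"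
  "x \<in> R \<Longrightarrow> a \<in> A \<Longrightarrow> x o\<^sub>C\<^sub>L a \<in> R"
  by (auto simp: R_def A_closed_ops bidual_embed_ops arens_linear arens_bidual_embed[symmetric]
      arens_assoc[symmetric])

lemma closed_R: "closed R"
proof -
  have "R = A \<inter> {x. p \<cdot>\<^sub>A bidual_embed x = bidual_one \<cdot>\<^sub>A bidual_embed x}"
    by (auto simp: R_def)
  then show ?thesis
    by (simp only:) (intro closed_Int A_closed_ops closed_Collect_eq continuous_arens_embed)
qed

lemma D_ops: "0 \<in> D" "x \<in> D \<Longrightarrow> y \<in> D \<Longrightarrow> x + y \<in> D" "x \<in> D \<Longrightarrow> c *\<^sub>R x \<in> D"
  using R_ops(3)[of x "complex_of_real c"]
  by (auto simp: D_def R_ops bidual_embed_ops arens_linear scaleC_of_real)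

lemma closed_D: "closed D"
proof -
  have "D = R \<inter> {x. bidual_embed x \<cdot>\<^sub>A p = bidual_embed x \<cdot>\<^sub>A bidual_one}"
    by (auto simp: D_def)
  then show ?thesis
    by (simp only:) (intro closed_Int closed_R closed_Collect_eq continuous_arens_embed)
qed

lemma D_subset_ideal: "D \<subseteq> ell_ideal A p"
  by (auto simp: D_def R_def ell_ideal_def)

text \<open>A functional that vanishes on the right ideal vanishes along the net which defines openness, and
  hence at its weak* limit \<open>p\<close>.\<close>

lemma p_bipolar: "p \<in> alg_bidual R"
proof (rule alg_bidualI)
  fix \<phi> :: "'h bop dual" assume zero: "\<And>a. a \<in> R \<Longrightarrow> cblinfun_apply \<phi> a = 0"
  obtain F :: "'h bop filter" where F: "F \<noteq> bot"
    "\<forall>\<^sub>F x in F. x \<in> A \<and> bidual_embed x = p \<cdot>\<^sub>A bidual_embed x"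
    "((\<lambda>x. cblinfun_apply (bidual_embed x) \<phi>) \<longlongrightarrow> cblinfun_apply p \<phi>) F"
    using open_p unfolding open_projection_def by blast
  have "\<forall>\<^sub>F x in F. cblinfun_apply (bidual_embed x) \<phi> = 0"
    using F(2) by eventually_elim (auto simp: bidual_embed.rep_eq R_def intro!: zero)
  then have "((\<lambda>x. cblinfun_apply (bidual_embed x) \<phi>) \<longlongrightarrow> 0) F"
    by (rule tendsto_eventually)
  then show "cblinfun_apply p \<phi> = 0"
    using tendsto_unique[OF F(1) F(3)] by blast
qed

lemma embed_p_bipolar:
  assumes "e \<in> R"
  shows "bidual_embed e \<cdot>\<^sub>A p \<in> alg_bidual R"
proof (rule alg_bidualI)
  fix \<phi> :: "'h bop dual" assume "\<And>a. a \<in> R \<Longrightarrow> cblinfun_apply \<phi> a = 0"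
  then have "arens_dual_op \<phi> e a = 0" if "a \<in> R" for a
    using R_ops(4)[OF assms R_A[OF that]] by (simp add: arens_dual_op.rep_eq)
  then show "(bidual_embed e \<cdot>\<^sub>A p) \<phi> = 0"
    using p_bipolar by (simp add: alg_bidual_def arens_embed_left)
qed

section \<open>From right ideal elements to two-sided ones\<close>

text \<open>In block form with respect to \<open>q\<close> and \<open>p\<close>, the \<open>q\<close>-column of \<open>1 - e\<close> consists of \<open>q\<close> and \<open>- eq\<close>, and
  its norm is at most \<open>M\<close>.\<close>

lemma norm_corner:
  assumes e: "e \<in> R" and M: "norm (id_op - e) \<le> M" "1 \<le> M"
  shows "(norm (bidual_embed e - bidual_embed e \<cdot>\<^sub>A p))\<^sup>2 \<le> M\<^sup>2 - 1"
proof -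
  let ?e = "bidual_embed e"
  let ?s = "?e \<cdot>\<^sub>A p - ?e"
  have "q + ?s = bidual_embed (id_op - e) \<cdot>\<^sub>A q"
    by (simp add: q_def arens_linear bidual_embed_ops)
  then have "norm (q + ?s) \<le> norm (bidual_embed (id_op - e)) * norm q"
    by (simp add: norm_arens)
  also have "\<dots> \<le> M * 1"
    using M by (intro mult_mono norm_projection_le_one projection_q order_trans[OF norm_bidual_embed]) auto
  finally have "norm (q + ?s) \<le> M"
    by simp
  moreover have "?s \<cdot>\<^sub>A q = ?s" "q \<cdot>\<^sub>A ?s = 0"
    by (simp_all add: q_def arens_linear arens_assoc projectionD[OF projection_p] R_p[OF e]
        arens_assoc[symmetric] projectionD(1)[OF projection_p])
  ultimately have "(norm ?s)\<^sup>2 \<le> M\<^sup>2 - 1"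
    using norm_projection_column[OF projection_q] M(2) by blast
  then show ?thesis
    by (simp add: norm_minus_commute)
qed

lemma R_contraction_imp_D:
  assumes "e \<in> R" "norm (id_op - e) \<le> 1"
  shows "e \<in> D"
  using norm_corner[OF assms] assms(1) by (simp add: D_def)

text \<open>The correction approximates the point \<open>\<eta>\<close> of the bipolar for which \<open>1 - e - \<eta> = q + (1 - \<delta>)p(1 - e)p\<close>:
  the corner \<open>eq\<close> is removed and the block under \<open>p\<close> is scaled down to norm at most \<open>1\<close>. Since \<open>\<parallel>eq\<parallel>\<close> is of order
  \<open>sqrt \<epsilon>\<close> and \<open>\<delta>\<close> of order \<open>\<epsilon>\<close>, the size of \<open>\<eta>\<close> is of order \<open>sqrt \<epsilon>\<close>.\<close>

lemma R_correction:
  assumes e: "e \<in> R" and \<epsilon>: "0 < \<epsilon>" "\<epsilon> \<le> 1" and ne: "norm (id_op - e) \<le> 1 + \<epsilon>" and \<tau>: "0 < \<tau>"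
  obtains e' where "e' \<in> R" "norm (id_op - e') \<le> 1 + \<tau>" "norm (e' - e) \<le> 4 * sqrt \<epsilon>"
proof -
  define \<delta> where "\<delta> = \<epsilon> / (1 + \<epsilon>)"
  have \<delta>: "0 \<le> \<delta>" "\<delta> * (1 + \<epsilon>) = \<epsilon>" "0 \<le> 1 - \<delta>" "(1 - \<delta>) * (1 + \<epsilon>) = 1"
    using \<epsilon> by (simp_all add: \<delta>_def field_simps)
  let ?e = "bidual_embed e"
  define c where "c = p - ?e \<cdot>\<^sub>A p"
  have c: "c = p \<cdot>\<^sub>A (bidual_embed (id_op - e) \<cdot>\<^sub>A p)"
    by (simp add: c_def bidual_embed_ops arens_linear projectionD[OF projection_p] R_p[OF e] arens_assoc[symmetric])
  have norm_c: "norm c \<le> 1 + \<epsilon>"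
  proof -
    have "norm c \<le> norm p * (norm (bidual_embed (id_op - e)) * norm p)"
      unfolding c by (meson norm_arens mult_left_mono norm_ge_zero order_trans)
    also have "\<dots> \<le> 1 * ((1 + \<epsilon>) * 1)"
      using \<epsilon> ne by (intro mult_mono norm_projection_le_one projection_p order_trans[OF norm_bidual_embed]) auto
    finally show ?thesis by simp
  qed
  define \<eta> where "\<eta> = \<delta> *\<^sub>R c - (?e - ?e \<cdot>\<^sub>A p)"
  have "\<eta> \<in> alg_bidual R"
    unfolding \<eta>_def c_def
    by (intro alg_bidual_ops p_bipolar embed_p_bipolar embed_in_alg_bidual e)
  moreover have "norm (bidual_embed id_op - ?e - \<eta>) \<le> 1"
  proof -
    have "bidual_embed id_op - ?e - \<eta> = q + (1 - \<delta>) *\<^sub>R c"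
      by (simp add: \<eta>_def c_def q_def algebra_simps)
    also have "norm \<dots> \<le> 1"
    proof (rule norm_orthogonal_sum_le)
      show "bidual_star q \<cdot>\<^sub>A ((1 - \<delta>) *\<^sub>R c) = 0"
        by (simp add: c projectionD[OF projection_q] arens_linear pq)
      have "bidual_star c = p \<cdot>\<^sub>A (bidual_star (bidual_embed (id_op - e)) \<cdot>\<^sub>A p)"
        by (simp add: c bidual_star_arens projectionD[OF projection_p] arens_assoc)
      then show "q \<cdot>\<^sub>A bidual_star ((1 - \<delta>) *\<^sub>R c) = 0"
        by (simp add: bidual_star_ops arens_linear pq)
      show "norm q \<le> 1"
        by (rule norm_projection_le_one[OF projection_q])
      show "norm ((1 - \<delta>) *\<^sub>R c) \<le> 1"
        using mult_left_mono[OF norm_c \<delta>(3)] \<delta> by simp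
    qed
    finally show ?thesis .
  qed
  moreover have "norm \<eta> \<le> 3 * sqrt \<epsilon>"
  proof -
    have "(norm (?e - ?e \<cdot>\<^sub>A p))\<^sup>2 \<le> (1 + \<epsilon>)\<^sup>2 - 1"
      using \<epsilon> by (intro norm_corner e ne) simp
    also have "\<dots> \<le> (2 * sqrt \<epsilon>)\<^sup>2"
      using \<epsilon> mult_left_le[of \<epsilon> \<epsilon>] by (simp add: power_mult_distrib) (simp add: power2_eq_square algebra_simps)
    finally have 1: "norm (?e - ?e \<cdot>\<^sub>A p) \<le> 2 * sqrt \<epsilon>"
      by (rule power2_le_imp_le) (use \<epsilon> in simp)
    have "norm (\<delta> *\<^sub>R c) \<le> \<epsilon>"
      using mult_left_mono[OF norm_c \<delta>(1)] \<delta> by simp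
    also have "\<dots> \<le> sqrt \<epsilon>"
      using \<epsilon> by (intro real_le_rsqrt) (simp add: power2_eq_square mult_left_le)
    finally show ?thesis
      using 1 norm_triangle_ineq4[of "\<delta> *\<^sub>R c" "?e - ?e \<cdot>\<^sub>A p"] by (simp add: \<eta>_def)
  qed
  moreover define \<tau>' where "\<tau>' = min \<tau> (sqrt \<epsilon>)"
  have "0 < \<tau>'"
    using \<tau> \<epsilon> by (simp add: \<tau>'_def)
  ultimately obtain r where r: "r \<in> R" "norm (id_op - e - r) \<le> 1 + \<tau>'" "norm r \<le> 3 * sqrt \<epsilon> + \<tau>'"
    using bipolar_approximation[OF R_ops(1-3) _ \<open>0 < \<tau>'\<close>, where \<eta> = \<eta> and u = "id_op - e" and v = 0
        and b = id_op]
    by (simp add: bidual_embed_ops) (smt (verit))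
  show ?thesis
  proof
    show "e + r \<in> R"
      by (rule R_ops(2)[OF e r(1)])
    show "norm (id_op - (e + r)) \<le> 1 + \<tau>"
      using r(2) by (simp add: \<tau>'_def diff_diff_eq)
    show "norm (e + r - e) \<le> 4 * sqrt \<epsilon>"
      using r(3) by (simp add: \<tau>'_def)
  qed
qed

lemma R_near_contraction:
  assumes "e \<in> R" "0 < \<epsilon>" "\<epsilon> \<le> 1" "norm (id_op - e) \<le> 1 + \<epsilon>"
  obtains e' where "e' \<in> D" "norm (id_op - e') \<le> 1" "norm (e' - e) \<le> 8 * sqrt \<epsilon>"
proof -
  obtain e' where "e' \<in> R" "norm (id_op - e') \<le> 1" "norm (e' - e) \<le> 2 * 4 * sqrt \<epsilon>"
  proof (rule successive_correction[OF closed_R _ assms(1,4,2,3), where C = 4])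
    show "\<exists>x'\<in>R. norm (id_op - x') \<le> 1 + \<tau> \<and> norm (x' - x) \<le> 4 * sqrt \<epsilon>"
      if "x \<in> R" "0 < \<epsilon>" "\<epsilon> \<le> 1" "0 < \<tau>" "norm (id_op - x) \<le> 1 + \<epsilon>" for x \<epsilon> \<tau>
      using R_correction[OF that(1,2,3,5,4)] by blast
  qed
  then show ?thesis
    using that[OF R_contraction_imp_D] by simp
qed

section \<open>Attaining the distance\<close>

lemma distance_lower_bound:
  assumes y: "y \<in> ell_ideal A p"
  shows "norm (bidual_embed b - bidual_embed b \<cdot>\<^sub>A p) \<le> norm (b - y)"
proof -
  have "bidual_embed b - bidual_embed b \<cdot>\<^sub>A p = bidual_embed (b - y) \<cdot>\<^sub>A q"
    using y by (simp add: q_def ell_ideal_def arens_linear bidual_embed_ops)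
  then have "norm (bidual_embed b - bidual_embed b \<cdot>\<^sub>A p) \<le> norm (bidual_embed (b - y)) * norm q"
    by (simp add: norm_arens)
  also have "\<dots> \<le> norm (b - y) * 1"
    by (intro mult_mono norm_bidual_embed norm_projection_le_one projection_q) auto
  finally show ?thesis
    by simp
qed

text \<open>For \<open>c = b - y\<close> the element \<open>c - \<delta>cp = cq + (1 - \<delta>)cp\<close> has norm at most \<open>d\<close>. The approximation of \<open>p\<close>
  by some \<open>e\<^sub>0\<close> in the right ideal has to keep \<open>\<parallel>c - \<delta>ce\<^sub>0\<parallel>\<close> and \<open>\<parallel>1 - e\<^sub>0\<parallel>\<close> small at the same time, so that
  \<open>e\<^sub>0\<close> can then be moved slightly to an \<open>e\<close> in the hereditary subalgebra.\<close>

lemma D_correction: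
  assumes b: "b \<in> A" "bidual_embed b \<cdot>\<^sub>A p = p \<cdot>\<^sub>A bidual_embed b"
    and d: "norm (bidual_embed b - bidual_embed b \<cdot>\<^sub>A p) \<le> d"
    and y: "y \<in> D" "norm (b - y) \<le> d + \<epsilon>" and \<epsilon>: "0 < \<epsilon>" and \<tau>: "0 < \<tau>"
  obtains y' where "y' \<in> D" "norm (b - y') \<le> d + \<tau>" "norm (y' - y) \<le> 2 * \<epsilon>"
proof -
  have d0: "0 \<le> d"
    using norm_ge_zero d by (rule order_trans)
  define \<delta> where "\<delta> = \<epsilon> / (d + \<epsilon>)"
  have \<delta>: "0 \<le> \<delta>" "\<delta> \<le> 1" "\<delta> * (d + \<epsilon>) = \<epsilon>" "(1 - \<delta>) * (d + \<epsilon>) = d"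
    using \<epsilon> d0 by (simp_all add: \<delta>_def field_simps)
  define c where "c = b - y"
  let ?c = "bidual_embed c"
  have cA: "c \<in> A"
    using A_diff b(1) y(1) by (simp add: c_def D_def R_A)
  have comm: "?c \<cdot>\<^sub>A p = p \<cdot>\<^sub>A ?c"
    using y(1) b(2) by (simp add: c_def bidual_embed_ops arens_linear D_def R_p)
  have cq: "?c - ?c \<cdot>\<^sub>A p = bidual_embed b - bidual_embed b \<cdot>\<^sub>A p"
    using y(1) by (simp add: c_def bidual_embed_ops arens_linear D_def)
  have cq': "?c - ?c \<cdot>\<^sub>A p = ?c \<cdot>\<^sub>A q" "q \<cdot>\<^sub>A ?c = ?c \<cdot>\<^sub>A q"
    by (simp_all add: q_def arens_linear comm)
  have norm_c: "norm c \<le> d + \<epsilon>"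
    using y(2) by (simp add: c_def)
  have target: "norm (?c - bidual_embed (\<delta> *\<^sub>R c) \<cdot>\<^sub>A p) \<le> d"
  proof -
    have "?c - bidual_embed (\<delta> *\<^sub>R c) \<cdot>\<^sub>A p = ?c \<cdot>\<^sub>A q + (1 - \<delta>) *\<^sub>R (?c \<cdot>\<^sub>A p)"
      by (simp add: cq'(1)[symmetric] bidual_embed_ops arens_linear algebra_simps)
    also have "norm \<dots> \<le> d"
    proof (rule norm_orthogonal_sum_le)
      have star: "bidual_star (?c \<cdot>\<^sub>A q) = q \<cdot>\<^sub>A bidual_star ?c"
        by (simp add: bidual_star_arens projectionD[OF projection_q])
      have "bidual_star ?c \<cdot>\<^sub>A p = p \<cdot>\<^sub>A bidual_star ?c"
        using arg_cong[OF comm, of bidual_star] by (simp add: bidual_star_arens projectionD[OF projection_p])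
      then have "bidual_star ?c \<cdot>\<^sub>A (?c \<cdot>\<^sub>A p) = p \<cdot>\<^sub>A (bidual_star ?c \<cdot>\<^sub>A ?c)"
        by (simp add: comm arens_assoc[symmetric])
      then show "bidual_star (?c \<cdot>\<^sub>A q) \<cdot>\<^sub>A ((1 - \<delta>) *\<^sub>R (?c \<cdot>\<^sub>A p)) = 0"
        by (simp add: star arens_linear arens_assoc pq)
      show "(?c \<cdot>\<^sub>A q) \<cdot>\<^sub>A bidual_star ((1 - \<delta>) *\<^sub>R (?c \<cdot>\<^sub>A p)) = 0"
        by (simp add: bidual_star_ops bidual_star_arens projectionD[OF projection_p] arens_linear arens_assoc pq)
      show "norm (?c \<cdot>\<^sub>A q) \<le> d"
        using d by (simp add: cq cq'(1)[symmetric])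
      have "norm (?c \<cdot>\<^sub>A p) \<le> norm ?c * norm p"
        by (rule norm_arens)
      also have "\<dots> \<le> (d + \<epsilon>) * 1"
        using norm_c norm_bidual_embed[of c] d0 \<epsilon>
        by (intro mult_mono norm_projection_le_one[OF projection_p]) auto
      finally show "norm ((1 - \<delta>) *\<^sub>R (?c \<cdot>\<^sub>A p)) \<le> d"
        using mult_left_mono[of "norm (?c \<cdot>\<^sub>A p)" "d + \<epsilon>" "1 - \<delta>"] \<delta> by simp
    qed
    finally show ?thesis .
  qed
  \<comment> \<open>Moving from \<open>e\<^sub>0\<close> to \<open>e\<close> costs a multiple of the square root of the tolerance, hence the
    tolerance \<open>\<rho>\<^sup>2\<close>.\<close>
  define \<rho> where "\<rho> = min 1 (\<tau> / (1 + 8 * norm c))"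
  have den: "0 < 1 + 8 * norm c"
    by (simp add: add_pos_nonneg)
  have \<rho>: "0 < \<rho>" "\<rho> \<le> 1" "(1 + 8 * norm c) * \<rho> \<le> \<tau>"
  proof -
    show "0 < \<rho>" "\<rho> \<le> 1"
      using \<tau> den by (simp_all add: \<rho>_def)
    have "(1 + 8 * norm c) * \<rho> \<le> (1 + 8 * norm c) * (\<tau> / (1 + 8 * norm c))"
      using den by (intro mult_left_mono) (simp_all add: \<rho>_def)
    then show "(1 + 8 * norm c) * \<rho> \<le> \<tau>"
      using den by simp
  qed
  have \<rho>2: "0 < \<rho>\<^sup>2" "\<rho>\<^sup>2 \<le> 1" "\<rho>\<^sup>2 \<le> \<rho>"
    using \<rho> by (simp_all add: power2_eq_square mult_le_one mult_left_le)
  obtain e0 where e0: "e0 \<in> R" "norm (id_op - e0) \<le> norm (bidual_one - p) + \<rho>\<^sup>2"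
    "norm (c - ((\<delta> *\<^sub>R c) o\<^sub>C\<^sub>L e0)) \<le> norm (?c - bidual_embed (\<delta> *\<^sub>R c) \<cdot>\<^sub>A p) + \<rho>\<^sup>2"
    by (rule bipolar_approximation[OF R_ops(1-3) p_bipolar \<rho>2(1)])
  have "norm (id_op - e0) \<le> 1 + \<rho>\<^sup>2"
    using e0(2) norm_projection_le_one[OF projection_q] by (simp add: q_def)
  then obtain e where e: "e \<in> D" "norm (id_op - e) \<le> 1" "norm (e - e0) \<le> 8 * sqrt (\<rho>\<^sup>2)"
    by (rule R_near_contraction[OF e0(1) \<rho>2(1,2)])
  have "norm e \<le> norm (id_op :: 'h bop) + norm (id_op - e)"
    using norm_triangle_ineq4[of id_op "id_op - e"] by simp
  then have norm_e: "norm e \<le> 2"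
    using norm_id_op[where 'a = 'h] e(2) by linarith
  define z where "z = (\<delta> *\<^sub>R c) o\<^sub>C\<^sub>L e"
  have z: "z \<in> D"
  proof -
    have zA: "z \<in> A"
      unfolding z_def using e(1) cA by (intro A_closed_ops(4) A_scaleR) (simp_all add: D_def R_A)
    have ez: "bidual_embed z = \<delta> *\<^sub>R (?c \<cdot>\<^sub>A bidual_embed e)"
      by (simp add: z_def cblinfun_compose_scaleR bidual_embed_ops arens_bidual_embed)
    have "p \<cdot>\<^sub>A (?c \<cdot>\<^sub>A bidual_embed e) = ?c \<cdot>\<^sub>A (p \<cdot>\<^sub>A bidual_embed e)"
      by (simp add: arens_assoc[symmetric] comm)
    then show ?thesis
      using e(1) zA by (simp add: D_def R_def ez arens_linear arens_assoc)
  qed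
  show ?thesis
  proof
    show "y + z \<in> D"
      by (rule D_ops(2)[OF y(1) z])
    have "b - (y + z) = (c - ((\<delta> *\<^sub>R c) o\<^sub>C\<^sub>L e0)) - ((\<delta> *\<^sub>R c) o\<^sub>C\<^sub>L (e - e0))"
      by (simp add: z_def c_def cblinfun_compose_diff)
    then have "norm (b - (y + z)) \<le> norm (c - ((\<delta> *\<^sub>R c) o\<^sub>C\<^sub>L e0)) + norm ((\<delta> *\<^sub>R c) o\<^sub>C\<^sub>L (e - e0))"
      by (simp only: norm_triangle_ineq4)
    also have "norm ((\<delta> *\<^sub>R c) o\<^sub>C\<^sub>L (e - e0)) \<le> norm c * (8 * \<rho>)"
    proof -
      have "norm ((\<delta> *\<^sub>R c) o\<^sub>C\<^sub>L (e - e0)) \<le> norm (\<delta> *\<^sub>R c) * norm (e - e0)"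
        by (rule norm_cblinfun_compose)
      also have "\<dots> \<le> norm c * (8 * \<rho>)"
        using \<delta> e(3) \<rho> by (intro mult_mono) (simp_all add: mult_left_le_one_le)
      finally show ?thesis .
    qed
    also have "norm (c - ((\<delta> *\<^sub>R c) o\<^sub>C\<^sub>L e0)) \<le> d + \<rho>"
      using e0(3) target \<rho>2(3) by linarith
    finally show "norm (b - (y + z)) \<le> d + \<tau>"
      using \<rho>(3) by (simp add: algebra_simps)
    have "norm z \<le> norm (\<delta> *\<^sub>R c) * norm e"
      unfolding z_def by (rule norm_cblinfun_compose)
    also have "\<dots> \<le> \<epsilon> * 2"
      using \<epsilon> mult_left_mono[OF norm_c \<delta>(1)] \<delta> norm_e by (intro mult_mono) simp_all
    finally show "norm (y + z - y) \<le> 2 * \<epsilon>"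
      by simp
  qed
qed

lemma distance_attained:
  assumes b: "b \<in> A" "bidual_embed b \<cdot>\<^sub>A p = p \<cdot>\<^sub>A bidual_embed b"
    and d: "norm (bidual_embed b - bidual_embed b \<cdot>\<^sub>A p) \<le> d"
  obtains x where "x \<in> D" "norm (b - x) \<le> d"
proof -
  \<comment> \<open>One correction from \<open>0\<close>, with a possibly large error, gives a start with error at most \<open>1\<close>.\<close>
  have "norm (b - 0) \<le> d + (norm b + 1)"
    using order_trans[OF norm_ge_zero d] by simp
  then obtain y where y: "y \<in> D" "norm (b - y) \<le> d + 1"
    using D_correction[OF b d D_ops(1), of "norm b + 1" 1] by (auto simp: add_nonneg_pos)
  show ?thesis
  proof (rule successive_correction[OF closed_D _ y, where C = 2])
    fix x and \<epsilon> \<tau> :: real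
    assume x: "x \<in> D" "0 < \<epsilon>" "\<epsilon> \<le> 1" "0 < \<tau>" "norm (b - x) \<le> d + \<epsilon>"
    have "\<epsilon> \<le> sqrt \<epsilon>"
      using x by (intro real_le_rsqrt) (simp add: power2_eq_square mult_left_le)
    moreover obtain x' where "x' \<in> D" "norm (b - x') \<le> d + \<tau>" "norm (x' - x) \<le> 2 * \<epsilon>"
      by (rule D_correction[OF b d x(1,5,2,4)])
    ultimately show "\<exists>x'\<in>D. norm (b - x') \<le> d + \<tau> \<and> norm (x' - x) \<le> 2 * sqrt \<epsilon>"
      by (intro bexI[of _ x']) auto
  qed (use that in auto)
qed

end

theorem theorem2p1:
  fixes A :: "('h::complex_hilbert_space \<Rightarrow>\<^sub>C\<^sub>L 'h) set"
    and p :: "('h \<Rightarrow>\<^sub>C\<^sub>L 'h) bidual"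
    and b :: "'h \<Rightarrow>\<^sub>C\<^sub>L 'h"
  assumes "operator_algebra A"
    and "open_projection A p"
    and "b \<in> A"
    and "bidual_embed b \<cdot>\<^sub>A p = p \<cdot>\<^sub>A bidual_embed b"
  shows "\<exists>x\<in>ell_ideal A p. norm (b - x) = (INF y\<in>ell_ideal A p. norm (b - y))"
proof -
  interpret open_projection_in A p
    using assms(1,2) by unfold_locales
  let ?d = "INF y\<in>ell_ideal A p. norm (b - y)"
  have ne: "ell_ideal A p \<noteq> {}"
    using D_ops(1) D_subset_ideal by blast
  have "norm (bidual_embed b - bidual_embed b \<cdot>\<^sub>A p) \<le> ?d"
    using distance_lower_bound by (rule cINF_greatest[OF ne])
  then obtain x where x: "x \<in> D" "norm (b - x) \<le> ?d"
    using distance_attained[OF assms(3,4)] by blast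
  have "?d \<le> norm (b - x)"
    using x(1) D_subset_ideal by (intro cINF_lower bdd_belowI2[where m = 0]) auto
  then show ?thesis
    using x D_subset_ideal by (intro bexI[of _ x]) auto
qed

end
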